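(* Let $(X,\|\cdot\|,\tau)$ be a Saks space with mixed topology $\gamma$ and submixed topology $\gamma_{\mathrm s}$, let $I$ be a Hausdorff topological space and $(S(t))_{t\in I}$ a family of linear maps from $X$ to $X$. Consider the following assertions. (a) $(S(t))_{t\in I}$ is $\tau$-bi-continuous. (a$_{\rm loc}$) $(S(t))_{t\in I}$ is locally $\tau$-bi-continuous. (b) $(S(t))_{t\in I}$ is $\gamma$-strongly continuous and $\gamma$-equicontinuous. (b$_{\rm loc}$) $(S(t))_{t\in I}$ is $\gamma$-strongly continuous and locally $\gamma$-equicontinuous. (c) $(S(t))_{t\in I}$ is $\gamma$-strongly continuous and $(\|\cdot\|,\tau)$-equitight. (c$_{\rm loc}$) $(S(t))_{t\in I}$ is $\gamma$-strongly continuous and locally $(\|\cdot\|,\tau)$-equitight. (d) $(S(t))_{t\in I}$ is $\gamma$-strongly continuous and $S(t)\in\mathcal L(X,\gamma)$ for all $t\in I$. Then the following holds. (i) If $(X,\gamma)$ is C-sequential and $I$ is a $k_{\mathrm{lcs}}$-space, then (a)$\Leftrightarrow$(b) and (a$_{\rm loc}$)$\Leftrightarrow$(b$_{\rm loc}$). (ii) If $\gamma=\gamma_{\mathrm s}$, then (b)$\Rightarrow$(c) and (b$_{\rm loc}$)$\Rightarrow$(c$_{\rm loc}$). If $(X,\|\cdot\|)$ is a Banach space and $(S(t))_{t\in I}$ is a family in $\mathcal L(X)$, then (c$_{\rm loc}$)$\Rightarrow$(b$_{\rm loc}$). If $(S(t))_{t\in I}$ is a family in $\mathcal L(X)$ and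 bounded, then (c)$\Rightarrow$(b). (iii) If $(X,\gamma)$ is a strong Mackey space, then (b$_{\rm loc}$)$\Leftrightarrow$(d). (iv) If $(X,\gamma)$ is a strong Mackey space and a Mazur space, and $I$ is a $k_{\mathrm{lcs}}$-space, then (a$_{\rm loc}$)$\Leftrightarrow$(b$_{\rm loc}$)$\Leftrightarrow$(d).
   Context: Linear spaces are over $\mathbb R$ or $\mathbb C$. For a Hausdorff locally convex space $(X,\tau)$, $\mathcal P_\tau$ denotes a directed system of seminorms generating $\tau$, $\mathcal L(X,\tau)$ the continuous linear maps $X\to X$, and $(X,\tau)'$ the topological dual. For a normed space $(X,\|\cdot\|)$, $\tau_{\|\cdot\|}$ is the norm topology and $\mathcal L(X)$ the bounded linear operators with the operator norm. Saks space: a triple $(X,\|\cdot\|,\tau)$ where $(X,\|\cdot\|)$ is a normed space and $\tau\subseteq\tau_{\|\cdot\|}$ is a Hausdorff locally convex topology on $X$ such that there is a directed system of seminorms $\mathcal P_\tau$ generating $\tau$ with $\|x\|=\sup_{p\in\mathcal P_\tau}p(x)$ for all $x\in X$ (fix such $\mathcal P_\tau$). Mixed topology $\gamma=\gamma(\|\cdot\|,\tau)$: the finest linear topology on $X$ that coincides with $\tau$ on $\|\cdot\|$-bounded sets and satisfies $\tau\subseteq\gamma\subseteq\tau_{\|\cdot\|}$; it is Hausdorff locally convex. Submixed topology $\gamma_{\mathrm s}$: the Hausdorff locally convex topology generated by the seminorms $x\mapsto\sup_{n\in\mathbb N}p_n(x)a_n$, where $(p_n)_{n\in\mathbb N}$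 runs through the sequences in $\mathcal P_\tau$ and $(a_n)_{n\in\mathbb N}$ through the non-negative real null sequences. A family $(S(t))_{t\in J}$ of linear maps $X\to X$ is: $\sigma$-strongly continuous (for a topology $\sigma$ on $X$ and $J$ a Hausdorff topological space) if $t\mapsto S(t)x\in(X,\sigma)$ is continuous for every $x\in X$; $\gamma$-equicontinuous if for every $p\in\mathcal P_\gamma$ there are $q\in\mathcal P_\gamma$, $K\ge0$ with $\sup_{t\in J}p(S(t)x)\le Kq(x)$ for all $x\in X$; bounded (for a family in $\mathcal L(X)$) if $\sup_{t\in J}\|S(t)\|_{\mathcal L(X)}<\infty$; bi-equicontinuous if for every $\|\cdot\|$-bounded sequence $(x_n)$ in $X$ and $x\in X$ with $x_n\to x$ w.r.t. $\tau$ one has $\tau$-$\lim_{n\to\infty}S(t)(x_n-x)=0$ uniformly for $t\in J$; $(\|\cdot\|,\tau)$-equitight if for all $\varepsilon>0$, $p\in\mathcal P_\tau$ there are $q\in\mathcal P_\tau$, $K\ge0$ such that $p(S(t)x)\le Kq(x)+\varepsilon\|x\|$ for all $t\in J$, $x\in X$. For a family indexed by a Hausdorff topological space $I$, "locally (property)" means that $(S(t))_{t\in M}$ has the property for every compact $M\subseteq I$. $(S(t))_{t\in I}$ is $\tau$-bi-continuous (resp. locally $\tau$-bi-continuous) if it is a family in $\mathcal L(X)$ that is $\tau$-strongly continuous, locally bounded, and bi-equicontinuous (resp. locally bi-equicontinuous). A Hausdorff locally convex space is C-sequential if every convex sequentially open subset is open ($U$ is sequentially open if every sequence converging to a point of $U$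 is eventually in $U$). A Hausdorff topological space $I$ is a $k_{\mathrm{lcs}}$-space if every map $f$ from $I$ to any Hausdorff locally convex space whose restriction to each compact subset of $I$ is continuous is continuous. A Hausdorff locally convex space $(X,\sigma)$ with dual $X'$ is a strong Mackey space if every $\sigma(X',X)$-compact subset of $X'$ is equicontinuous; it is a Mazur space if every sequentially continuous linear functional on it is continuous.
   Formalization: In (i), (a)⇔(b) is proved with (a) strengthened by boundedness of the whole family (S(t))_{t∈I}; as printed, (a)⇒(b) fails: S(n)x = n·x_0·e_n on ℓ^∞ with pointwise convergence, I = ℕ discrete. *)

theory Defs
  imports "HOL-Analysis.Analysis" "HOL-Library.Function_Algebras"
begin

section \<open>Scalars and vector spaces\<close>

text \<open>The scalar fields are exactly the isometric copies of \<open>\<real>\<close> and \<open>\<complex>\<close>.\<close>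

class real_or_complex = real_normed_field +
  assumes real_or_complex:
    "(\<exists>\<phi>::'a \<Rightarrow> real. bij \<phi> \<and> (\<forall>x y. \<phi> (x + y) = \<phi> x + \<phi> y) \<and>
        (\<forall>x y. \<phi> (x * y) = \<phi> x * \<phi> y) \<and> (\<forall>r x. \<phi> (r *\<^sub>R x) = r *\<^sub>R \<phi> x) \<and>
        (\<forall>x. norm (\<phi> x) = norm x)) \<or>
     (\<exists>\<phi>::'a \<Rightarrow> complex. bij \<phi> \<and> (\<forall>x y. \<phi> (x + y) = \<phi> x + \<phi> y) \<and>
        (\<forall>x y. \<phi> (x * y) = \<phi> x * \<phi> y) \<and> (\<forall>r x. \<phi> (r *\<^sub>R x) = r *\<^sub>R \<phi> x) \<and>
        (\<forall>x. norm (\<phi> x) = norm x))"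

instance real :: real_or_complex
  by standard (rule disjI1, rule exI[of _ id], simp)

instance complex :: real_or_complex
  by standard (rule disjI2, rule exI[of _ id], simp)

text \<open>A normed space over the scalar field \<open>'k\<close>. The norm, its topology \<open>euclidean\<close>, and the
  underlying real vector space are those of the type class \<open>real_normed_vector\<close>; \<open>smul\<close> extends
  the real scalar multiplication.\<close>

locale normed_space_over = vector_space smul
  for smul :: "'k::real_or_complex \<Rightarrow> 'a::real_normed_vector \<Rightarrow> 'a" +
  assumes norm_scale: "norm (smul c x) = norm c * norm x"
    and scale_of_real: "smul (of_real r) x = r *\<^sub>R x"

section \<open>Seminorms and locally convex topologies\<close>

text \<open>All topologies on a vector space \<open>'a\<close> below have \<open>topspace\<close> equal to \<open>UNIV\<close>.\<close>

definition seminorm :: "('k::real_normed_field \<Rightarrow> 'a::ab_group_add \<Rightarrow> 'a) \<Rightarrow> ('a \<Rightarrow> real) \<Rightarrow> bool"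
  where "seminorm smul p \<longleftrightarrow> (\<forall>x. 0 \<le> p x) \<and> (\<forall>x y. p (x + y) \<le> p x + p y) \<and>
    (\<forall>c x. p (smul c x) = norm c * p x)"

text \<open>Directedness is required only up to a constant. This includes systems that are directed for
  the pointwise order.\<close>

definition directed_seminorms ::
    "('k::real_normed_field \<Rightarrow> 'a::ab_group_add \<Rightarrow> 'a) \<Rightarrow> ('a \<Rightarrow> real) set \<Rightarrow> bool"
  where "directed_seminorms smul P \<longleftrightarrow> P \<noteq> {} \<and> (\<forall>p\<in>P. seminorm smul p) \<and>
    (\<forall>p\<in>P. \<forall>q\<in>P. \<exists>r\<in>P. \<exists>C\<ge>0. \<forall>x. max (p x) (q x) \<le> C * r x)"

definition seminorm_topology :: "('a::ab_group_add \<Rightarrow> real) set \<Rightarrow> 'a topology"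
  where "seminorm_topology P =
    topology_generated_by {{y. p (y - x) < r} |p x r. p \<in> P \<and> 0 < r}"

definition hausdorff_lcs ::
    "('k::real_normed_field \<Rightarrow> 'a::ab_group_add \<Rightarrow> 'a) \<Rightarrow> 'a topology \<Rightarrow> bool"
  where "hausdorff_lcs smul T \<longleftrightarrow> vector_space smul \<and> Hausdorff_space T \<and>
    (\<exists>P. directed_seminorms smul P \<and> T = seminorm_topology P)"

definition linear_topology ::
    "('k::real_normed_field \<Rightarrow> 'a::ab_group_add \<Rightarrow> 'a) \<Rightarrow> 'a topology \<Rightarrow> bool"
  where "linear_topology smul T \<longleftrightarrow> topspace T = UNIV \<and>
    continuous_map (prod_topology T T) T (\<lambda>(x, y). x + y) \<and>
    continuous_map (prod_topology euclidean T) T (\<lambda>(c, x). smul c x)"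

abbreviation coarser :: "'a topology \<Rightarrow> 'a topology \<Rightarrow> bool"
  where "coarser T T' \<equiv> (\<forall>U. openin T U \<longrightarrow> openin T' U)"

section \<open>Saks spaces, mixed and submixed topology\<close>

text \<open>The norming system \<open>P\<close> is part of the data.\<close>

locale saks_space = normed_space_over smul
  for smul :: "'k::real_or_complex \<Rightarrow> 'a::real_normed_vector \<Rightarrow> 'a" +
  fixes \<tau> :: "'a topology" and P :: "('a \<Rightarrow> real) set"
  assumes directed: "directed_seminorms smul P"
    and generates: "\<tau> = seminorm_topology P"
    and Hausdorff: "Hausdorff_space \<tau>"
    and coarser_norm: "coarser \<tau> euclidean"
    and bounded_above: "bdd_above ((\<lambda>p. p x) ` P)"
    and norm_eq_SUP: "norm x = (SUP p\<in>P. p x)"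

definition mixed_candidate ::
    "('k::real_or_complex \<Rightarrow> 'a::real_normed_vector \<Rightarrow> 'a) \<Rightarrow> 'a topology \<Rightarrow> 'a topology \<Rightarrow> bool"
  where "mixed_candidate smul \<tau> \<gamma> \<longleftrightarrow> linear_topology smul \<gamma> \<and>
    (\<forall>B. bounded B \<longrightarrow> subtopology \<gamma> B = subtopology \<tau> B) \<and>
    coarser \<tau> \<gamma> \<and> coarser \<gamma> euclidean"

definition mixed_topology ::
    "('k::real_or_complex \<Rightarrow> 'a::real_normed_vector \<Rightarrow> 'a) \<Rightarrow> 'a topology \<Rightarrow> 'a topology"
  where "mixed_topology smul \<tau> =
    (THE \<gamma>. mixed_candidate smul \<tau> \<gamma> \<and> (\<forall>\<sigma>. mixed_candidate smul \<tau> \<sigma> \<longrightarrow> coarser \<sigma> \<gamma>))"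

definition submixed_topology :: "('a::ab_group_add \<Rightarrow> real) set \<Rightarrow> 'a topology"
  where "submixed_topology P = seminorm_topology
    {(\<lambda>x. SUP n. p n x * a n) |(p :: nat \<Rightarrow> 'a \<Rightarrow> real) (a :: nat \<Rightarrow> real).
       range p \<subseteq> P \<and> (\<forall>n. 0 \<le> a n) \<and> a \<longlonglongrightarrow> 0}"

section \<open>Families of linear maps\<close>

text \<open>A family is a function \<open>S\<close> of which only the values on the index set \<open>J\<close> matter.\<close>

definition strongly_continuous :: "'i topology \<Rightarrow> 'b topology \<Rightarrow> ('i \<Rightarrow> 'a \<Rightarrow> 'b) \<Rightarrow> bool"
  where "strongly_continuous I \<sigma> S \<longleftrightarrow> (\<forall>x. continuous_map I \<sigma> (\<lambda>t. S t x))"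

definition on_compacts :: "'i topology \<Rightarrow> ('i set \<Rightarrow> bool) \<Rightarrow> bool"
  where "on_compacts I Q \<longleftrightarrow> (\<forall>M. compactin I M \<longrightarrow> Q M)"

text \<open>The largest directed system of seminorms generating a locally convex topology. Equicontinuity
  does not depend on the generating system: see \<open>equicontinuous_family_generating\<close> below.\<close>

definition continuous_seminorms ::
    "('k::real_normed_field \<Rightarrow> 'a::ab_group_add \<Rightarrow> 'a) \<Rightarrow> 'a topology \<Rightarrow> ('a \<Rightarrow> real) set"
  where "continuous_seminorms smul T = {p. seminorm smul p \<and> continuous_map T euclideanreal p}"

definition equicontinuous_wrt :: "('a \<Rightarrow> real) set \<Rightarrow> 'i set \<Rightarrow> ('i \<Rightarrow> 'a \<Rightarrow> 'a) \<Rightarrow> bool"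
  where "equicontinuous_wrt P J S \<longleftrightarrow>
    (\<forall>p\<in>P. \<exists>q\<in>P. \<exists>K\<ge>0. \<forall>t\<in>J. \<forall>x. p (S t x) \<le> K * q x)"

definition equicontinuous_family ::
    "('k::real_normed_field \<Rightarrow> 'a::ab_group_add \<Rightarrow> 'a) \<Rightarrow> 'a topology \<Rightarrow> 'i set \<Rightarrow>
      ('i \<Rightarrow> 'a \<Rightarrow> 'a) \<Rightarrow> bool"
  where "equicontinuous_family smul T J S \<longleftrightarrow>
    equicontinuous_wrt (continuous_seminorms smul T) J S"

definition bounded_family :: "'i set \<Rightarrow> ('i \<Rightarrow> 'a::real_normed_vector \<Rightarrow> 'a) \<Rightarrow> bool"
  where "bounded_family J S \<longleftrightarrow> bdd_above ((\<lambda>t. onorm (S t)) ` J)"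

definition bi_equicontinuous ::
    "'a::real_normed_vector topology \<Rightarrow> 'i set \<Rightarrow> ('i \<Rightarrow> 'a \<Rightarrow> 'a) \<Rightarrow> bool"
  where "bi_equicontinuous \<tau> J S \<longleftrightarrow>
    (\<forall>u x. bounded (range u) \<and> limitin \<tau> u x sequentially \<longrightarrow>
      (\<forall>U. openin \<tau> U \<and> 0 \<in> U \<longrightarrow> (\<forall>\<^sub>F n in sequentially. \<forall>t\<in>J. S t (u n - x) \<in> U)))"

definition equitight ::
    "('a::real_normed_vector \<Rightarrow> real) set \<Rightarrow> 'i set \<Rightarrow> ('i \<Rightarrow> 'a \<Rightarrow> 'a) \<Rightarrow> bool"
  where "equitight P J S \<longleftrightarrow>
    (\<forall>\<epsilon>>0. \<forall>p\<in>P. \<exists>q\<in>P. \<exists>K\<ge>0. \<forall>t\<in>J. \<forall>x. p (S t x) \<le> K * q x + \<epsilon> * norm x)"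

text \<open>For linear maps over \<open>'k\<close>, membership in the space of bounded operators is \<open>bounded_linear\<close>.
  Bi-continuity includes boundedness on compact index sets only. For non-compact \<open>I\<close> this does not
  imply \<open>bounded_family (topspace I) S\<close>: on \<open>\<ell>\<^sup>\<infinity>\<close> with pointwise convergence, the family
  \<open>S n x = n * x 0 * e n\<close> over discrete \<open>\<nat>\<close> is bi-continuous and unbounded.\<close>

definition bi_continuous ::
    "'i topology \<Rightarrow> 'a::real_normed_vector topology \<Rightarrow> ('i \<Rightarrow> 'a \<Rightarrow> 'a) \<Rightarrow> bool"
  where "bi_continuous I \<tau> S \<longleftrightarrow> (\<forall>t\<in>topspace I. bounded_linear (S t)) \<and>
    strongly_continuous I \<tau> S \<and> on_compacts I (\<lambda>M. bounded_family M S) \<and>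
    bi_equicontinuous \<tau> (topspace I) S"

definition locally_bi_continuous ::
    "'i topology \<Rightarrow> 'a::real_normed_vector topology \<Rightarrow> ('i \<Rightarrow> 'a \<Rightarrow> 'a) \<Rightarrow> bool"
  where "locally_bi_continuous I \<tau> S \<longleftrightarrow> (\<forall>t\<in>topspace I. bounded_linear (S t)) \<and>
    strongly_continuous I \<tau> S \<and> on_compacts I (\<lambda>M. bounded_family M S) \<and>
    on_compacts I (\<lambda>M. bi_equicontinuous \<tau> M S)"

section \<open>Properties of spaces\<close>

text \<open>The next predicates are meant for Hausdorff locally convex topologies.\<close>

definition C_sequential :: "'a::real_vector topology \<Rightarrow> bool"
  where "C_sequential T \<longleftrightarrow>
    (\<forall>U. convex U \<and>
         (\<forall>u. \<forall>x\<in>U. limitin T u x sequentially \<longrightarrow> (\<forall>\<^sub>F n in sequentially. u n \<in> U)) \<longrightarrow>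
         openin T U)"

definition dual :: "('k::real_normed_field \<Rightarrow> 'a::ab_group_add \<Rightarrow> 'a) \<Rightarrow> 'a topology \<Rightarrow> ('a \<Rightarrow> 'k) set"
  where "dual smul T = {f. Vector_Spaces.linear smul (*) f \<and> continuous_map T euclidean f}"

text \<open>\<open>\<sigma>(X', X)\<close>, the topology of pointwise convergence on the dual\<close>

definition weak_star ::
    "('k::real_normed_field \<Rightarrow> 'a::ab_group_add \<Rightarrow> 'a) \<Rightarrow> 'a topology \<Rightarrow> ('a \<Rightarrow> 'k) topology"
  where "weak_star smul T = subtopology (product_topology (\<lambda>_. euclidean) UNIV) (dual smul T)"

definition strong_Mackey ::
    "('k::real_normed_field \<Rightarrow> 'a::ab_group_add \<Rightarrow> 'a) \<Rightarrow> 'a topology \<Rightarrow> bool"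
  where "strong_Mackey smul T \<longleftrightarrow>
    (\<forall>F. compactin (weak_star smul T) F \<longrightarrow>
      (\<exists>q\<in>continuous_seminorms smul T. \<exists>K\<ge>0. \<forall>f\<in>F. \<forall>x. norm (f x) \<le> K * q x))"

definition Mazur ::
    "('k::real_normed_field \<Rightarrow> 'a::ab_group_add \<Rightarrow> 'a) \<Rightarrow> 'a topology \<Rightarrow> bool"
  where "Mazur smul T \<longleftrightarrow>
    (\<forall>f. Vector_Spaces.linear smul (*) f \<and>
         (\<forall>u x. limitin T u x sequentially \<longrightarrow> (\<lambda>n. f (u n)) \<longlonglongrightarrow> f x) \<longrightarrow>
         continuous_map T euclidean f)"

text \<open>HOL cannot quantify over all types inside a formula, so the range spaces are the real Hausdorff
  locally convex spaces carried by the type \<open>'i \<Rightarrow> real\<close>, with arbitrary scalar multiplication. This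
  is no restriction: the lemma \<open>k_lcs_spaceD\<close> below gives the defining property for real or complex
  Hausdorff locally convex spaces of every type.\<close>

definition k_lcs_space :: "'i topology \<Rightarrow> bool"
  where "k_lcs_space I \<longleftrightarrow> Hausdorff_space I \<and>
    (\<forall>(s :: real \<Rightarrow> ('i \<Rightarrow> real) \<Rightarrow> 'i \<Rightarrow> real) T f. hausdorff_lcs s T \<longrightarrow>
      (\<forall>M. compactin I M \<longrightarrow> continuous_map (subtopology I M) T f) \<longrightarrow> continuous_map I T f)"


section \<open>Generating seminorms\<close>

lemma seminormD:
  assumes "vector_space smul" "seminorm smul p"
  shows "p 0 = 0" "p (- x) = p x" "0 \<le> p x" "p (x + y) \<le> p x + p y" "p (smul c x) = norm c * p x"
    "p (x - z) \<le> p (x - y) + p (y - z)" "p (x - y) = p (y - x)"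
proof -
  interpret vector_space smul by fact
  show 0: "0 \<le> p x" "p (x + y) \<le> p x + p y" "p (smul c x) = norm c * p x" for x y c
    using assms by (auto simp: seminorm_def)
  show "p 0 = 0" using 0(3)[of 0 0] by simp
  show neg: "p (- x) = p x" for x using 0(3)[of "-1" x] by simp
  show "p (x - y) = p (y - x)" using neg[of "x - y"] by simp
  show "p (x - z) \<le> p (x - y) + p (y - z)" using 0(2)[of "x - y" "y - z"] by simp
qed

lemma openin_seminorm_topology:
  assumes vs: "vector_space smul" and dir: "directed_seminorms smul P"
  shows "openin (seminorm_topology P) U \<longleftrightarrow>
    (\<forall>x\<in>U. \<exists>p\<in>P. \<exists>r>0. \<forall>y. p (y - x) < r \<longrightarrow> y \<in> U)" (is "_ \<longleftrightarrow> ?R U")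
proof
  have sn: "seminorm smul p" if "p \<in> P" for p using dir that by (auto simp: directed_seminorms_def)
  assume "openin (seminorm_topology P) U"
  then have "generate_topology_on {{y. p (y - x) < r} |p x r. p \<in> P \<and> 0 < r} U"
    by (simp add: seminorm_topology_def openin_topology_generated_by_iff)
  then show "?R U"
  proof induction
    case Empty
    then show ?case by simp
  next
    case (Int a b)
    show ?case
    proof
      fix x assume x: "x \<in> a \<inter> b"
      from Int x obtain p r where p: "p \<in> P" "r > 0" "\<And>y. p (y - x) < r \<Longrightarrow> y \<in> a" by blast
      from Int x obtain q s where q: "q \<in> P" "s > 0" "\<And>y. q (y - x) < s \<Longrightarrow> y \<in> b" by blast
      from dir p q obtain w C where w: "w \<in> P" "C \<ge> 0" "\<And>x. max (p x) (q x) \<le> C * w x"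
        unfolding directed_seminorms_def by blast
      define e where "e = min r s / (C + 1)"
      have e: "e > 0" using p q w by (simp add: e_def)
      have "y \<in> a \<inter> b" if "w (y - x) < e" for y
      proof -
        have "C * w (y - x) \<le> C * e" using that w by (simp add: mult_left_mono)
        also have "\<dots> < (C + 1) * e" using e by (simp add: algebra_simps)
        also have "\<dots> = min r s" using w by (simp add: e_def)
        finally show ?thesis using w(3)[of "y - x"] p q by auto
      qed
      then show "\<exists>p\<in>P. \<exists>r>0. \<forall>y. p (y - x) < r \<longrightarrow> y \<in> a \<inter> b" using w e by blast
    qed
  next
    case (UN K)
    then show ?case by (meson Union_iff)
  next
    case (Basis s)
    then obtain p x r where s: "s = {y. p (y - x) < r}" "p \<in> P" "0 < r" by auto
    show ?case
    proof
      fix z assume "z \<in> s"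
      then have z: "r - p (z - x) > 0" using s by simp
      have "y \<in> s" if "p (y - z) < r - p (z - x)" for y
        using that seminormD(6)[OF vs sn[OF s(2)], of y x z] s by simp
      then show "\<exists>p\<in>P. \<exists>r>0. \<forall>y. p (y - z) < r \<longrightarrow> y \<in> s" using z s by blast
    qed
  qed
next
  have sn: "seminorm smul p" if "p \<in> P" for p using dir that by (auto simp: directed_seminorms_def)
  assume R: "?R U"
  show "openin (seminorm_topology P) U"
  proof (subst openin_subopen, intro ballI)
    fix x assume "x \<in> U"
    with R obtain p r where p: "p \<in> P" "r > 0" "\<And>y. p (y - x) < r \<Longrightarrow> y \<in> U" by blast
    have "openin (seminorm_topology P) {y. p (y - x) < r}"
      unfolding seminorm_topology_def by (rule topology_generated_by_Basis) (use p in blast)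
    moreover have "x \<in> {y. p (y - x) < r}" using p seminormD(1)[OF vs sn[OF p(1)]] by simp
    ultimately show "\<exists>V. openin (seminorm_topology P) V \<and> x \<in> V \<and> V \<subseteq> U" using p by blast
  qed
qed

lemma topspace_seminorm_topology:
  assumes vs: "vector_space smul" and dir: "directed_seminorms smul P"
  shows "topspace (seminorm_topology P) = UNIV"
proof -
  have "openin (seminorm_topology P) UNIV"
    using dir by (auto simp: openin_seminorm_topology[OF assms] directed_seminorms_def intro: exI[of _ 1])
  then show ?thesis by (metis openin_subset top.extremum_uniqueI)
qed

lemma openin_seminorm_ball:
  assumes vs: "vector_space smul" and dir: "directed_seminorms smul P" and "p \<in> P"
  shows "openin (seminorm_topology P) {y. p (y - x) < r}"
proof -
  have sn: "seminorm smul p" using dir assms(3) by (auto simp: directed_seminorms_def)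
  show ?thesis
  proof (cases "r > 0")
    case True
    then show ?thesis
      unfolding seminorm_topology_def by (intro topology_generated_by_Basis) (use assms(3) in blast)
  next
    case False
    then have "{y. p (y - x) < r} = {}" using seminormD(3)[OF vs sn] by (smt (verit) Collect_empty_eq)
    then show ?thesis by simp
  qed
qed

lemma continuous_map_seminorm_topology:
  assumes vs: "vector_space smul" and dir: "directed_seminorms smul P"
  shows "continuous_map Z (seminorm_topology P) g \<longleftrightarrow>
    (\<forall>t0\<in>topspace Z. \<forall>p\<in>P. \<forall>r>0. \<exists>V. openin Z V \<and> t0 \<in> V \<and> (\<forall>t\<in>V. p (g t - g t0) < r))"
    (is "_ \<longleftrightarrow> ?R")
proof
  have sn: "seminorm smul p" if "p \<in> P" for p using dir that by (auto simp: directed_seminorms_def)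
  assume L: "continuous_map Z (seminorm_topology P) g"
  show ?R
  proof (intro ballI allI impI)
    fix t0 p and r :: real assume t0: "t0 \<in> topspace Z" "p \<in> P" "0 < r"
    define V where "V = {t \<in> topspace Z. g t \<in> {y. p (y - g t0) < r}}"
    have "openin Z V"
      unfolding V_def by (rule openin_continuous_map_preimage[OF L openin_seminorm_ball[OF assms t0(2)]])
    moreover have "t0 \<in> V" using t0 seminormD(1)[OF vs sn[OF t0(2)]] by (simp add: V_def)
    ultimately show "\<exists>V. openin Z V \<and> t0 \<in> V \<and> (\<forall>t\<in>V. p (g t - g t0) < r)"
      by (auto simp: V_def)
  qed
next
  assume R: ?R
  show "continuous_map Z (seminorm_topology P) g"
    unfolding continuous_map_def
  proof (intro conjI allI impI)
    show "g \<in> topspace Z \<rightarrow> topspace (seminorm_topology P)"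
      by (simp add: topspace_seminorm_topology[OF assms])
    fix U assume U: "openin (seminorm_topology P) U"
    show "openin Z {x \<in> topspace Z. g x \<in> U}"
    proof (subst openin_subopen, intro ballI)
      fix t0 assume t0: "t0 \<in> {x \<in> topspace Z. g x \<in> U}"
      have "\<forall>x\<in>U. \<exists>p\<in>P. \<exists>r>0. \<forall>y. p (y - x) < r \<longrightarrow> y \<in> U"
        using U unfolding openin_seminorm_topology[OF assms] .
      with t0 obtain p r where p: "p \<in> P" "r > 0" "\<And>y. p (y - g t0) < r \<Longrightarrow> y \<in> U"
        by blast
      have "t0 \<in> topspace Z" using t0 by simp
      from R[rule_format, OF this p(1,2)]
      obtain V where V: "openin Z V" "t0 \<in> V" "\<And>t. t \<in> V \<Longrightarrow> p (g t - g t0) < r"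
        by auto
      have "V \<subseteq> {x \<in> topspace Z. g x \<in> U}"
        using p(3)[OF V(3)] openin_subset[OF V(1)] by auto
      then show "\<exists>V. openin Z V \<and> t0 \<in> V \<and> V \<subseteq> {x \<in> topspace Z. g x \<in> U}"
        using V(1,2) by auto
    qed
  qed
qed

lemma Hausdorff_space_seminorm_topology:
  assumes vs: "vector_space smul" and dir: "directed_seminorms smul P"
  shows "Hausdorff_space (seminorm_topology P) \<longleftrightarrow> (\<forall>x. x \<noteq> 0 \<longrightarrow> (\<exists>p\<in>P. p x \<noteq> 0))"
proof
  have sn: "seminorm smul p" if "p \<in> P" for p using dir that by (auto simp: directed_seminorms_def)
  note sD = seminormD[OF vs sn]
  {
    assume H: "Hausdorff_space (seminorm_topology P)"
    show "\<forall>x. x \<noteq> 0 \<longrightarrow> (\<exists>p\<in>P. p x \<noteq> 0)"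
    proof (intro allI impI, rule ccontr)
      fix x :: 'b assume x: "x \<noteq> 0" and n: "\<not> (\<exists>p\<in>P. p x \<noteq> 0)"
      from H x obtain U V where UV: "openin (seminorm_topology P) U" "openin (seminorm_topology P) V"
          "x \<in> U" "0 \<in> V" "disjnt U V"
        unfolding Hausdorff_space_def topspace_seminorm_topology[OF assms] by blast
      from UV(2,4) obtain p r where p: "p \<in> P" "r > 0" "\<And>y. p (y - 0) < r \<Longrightarrow> y \<in> V"
        using openin_seminorm_topology[OF assms] by blast
      have "x \<in> V" using n p by auto
      then show False using UV by (auto simp: disjnt_def)
    qed
  }
  assume R: "\<forall>x. x \<noteq> 0 \<longrightarrow> (\<exists>p\<in>P. p x \<noteq> 0)"
  show "Hausdorff_space (seminorm_topology P)"
    unfolding Hausdorff_space_def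
  proof (intro allI impI)
    fix x y assume "x \<in> topspace (seminorm_topology P) \<and> y \<in> topspace (seminorm_topology P) \<and> x \<noteq> y"
    with R obtain p where p: "p \<in> P" "p (x - y) \<noteq> 0" by (metis right_minus_eq)
    define r where "r = p (x - y) / 2"
    have r: "r > 0" using p sD(3)[OF p(1), of "x - y"] by (simp add: r_def)
    have "disjnt {z. p (z - x) < r} {z. p (z - y) < r}"
    proof -
      have False if "p (z - x) < r" "p (z - y) < r" for z
        using that sD(6)[OF p(1), of x y z] sD(7)[OF p(1), of x z] by (simp add: r_def)
      then show ?thesis by (auto simp: disjnt_iff)
    qed
    then show "\<exists>U V. openin (seminorm_topology P) U \<and> openin (seminorm_topology P) V \<and>
        x \<in> U \<and> y \<in> V \<and> disjnt U V"
      using openin_seminorm_ball[OF assms p(1)] r sD(1)[OF p(1)]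
      by (intro exI[of _ "{z. p (z - x) < r}"] exI[of _ "{z. p (z - y) < r}"]) simp
  qed
qed

lemma continuous_seminormI:
  assumes vs: "vector_space smul" and dir: "directed_seminorms smul P" and "p \<in> P"
  shows "p \<in> continuous_seminorms smul (seminorm_topology P)"
proof -
  have sn: "seminorm smul p" using dir assms(3) by (auto simp: directed_seminorms_def)
  note sD = seminormD[OF vs sn]
  have "continuous_map (seminorm_topology P) euclideanreal p"
    unfolding continuous_map_def
  proof (intro conjI allI impI)
    show "p \<in> topspace (seminorm_topology P) \<rightarrow> topspace euclideanreal" by simp
    fix U :: "real set" assume "openin euclidean U"
    then have U: "open U" by simp
    show "openin (seminorm_topology P) {x \<in> topspace (seminorm_topology P). p x \<in> U}"
      unfolding openin_seminorm_topology[OF vs dir] topspace_seminorm_topology[OF vs dir]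
    proof safe
      fix x assume "p x \<in> U"
      with U obtain e where e: "e > 0" "\<And>y. dist y (p x) < e \<Longrightarrow> y \<in> U" by (meson open_dist)
      have "p y \<in> U" if "p (y - x) < e" for y
      proof (rule e(2))
        have "\<bar>p y - p x\<bar> \<le> p (y - x)"
          using sD(6)[of y 0 x] sD(6)[of x 0 y] sD(7)[of x y] by simp
        then show "dist (p y) (p x) < e" using that by (simp add: dist_real_def)
      qed
      then show "\<exists>q\<in>P. \<exists>r>0. \<forall>y. q (y - x) < r \<longrightarrow> y \<in> {x \<in> UNIV. p x \<in> U}"
        using e assms(3) by blast
    qed
  qed
  then show ?thesis using sn by (simp add: continuous_seminorms_def)
qed

lemma continuous_seminorm_dominated:
  assumes vs: "vector_space smul" and dir: "directed_seminorms smul P"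
    and q: "q \<in> continuous_seminorms smul (seminorm_topology P)"
  shows "\<exists>p\<in>P. \<exists>C\<ge>0. \<forall>x. q x \<le> C * p x"
proof -
  interpret vector_space smul by fact
  have snq: "seminorm smul q" and cq: "continuous_map (seminorm_topology P) euclideanreal q"
    using q by (auto simp: continuous_seminorms_def)
  note qD = seminormD[OF vs snq]
  have "openin (seminorm_topology P) {x \<in> topspace (seminorm_topology P). q x \<in> {..<1}}"
    by (rule openin_continuous_map_preimage[OF cq]) simp
  moreover have "0 \<in> {x \<in> topspace (seminorm_topology P). q x \<in> {..<1}}"
    by (simp add: topspace_seminorm_topology[OF vs dir] qD)
  ultimately obtain p r where p: "p \<in> P" "r > 0" and *: "\<And>y. p (y - 0) < r \<Longrightarrow> q y < 1"
    unfolding openin_seminorm_topology[OF vs dir] by blast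
  have snp: "seminorm smul p" using dir p by (auto simp: directed_seminorms_def)
  note pD = seminormD[OF vs snp]
  have "q x \<le> (2 / r) * p x" for x
  proof (rule ccontr)
    assume n: "\<not> q x \<le> (2 / r) * p x"
    then have qx: "q x > 0" using pD(3)[of x] p by (smt (verit) divide_nonneg_pos mult_nonneg_nonneg)
    define c :: 'a where "c = of_real (1 / q x)"
    have nc: "norm c = 1 / q x" using qx by (simp add: c_def norm_divide)
    have "p (smul c x) = p x / q x" using pD(5) nc by simp
    also have "\<dots> < r" using n qx p(2) pD(3)[of x] by (simp add: field_simps)
    finally have "q (smul c x) < 1" using * by simp
    moreover have "q (smul c x) = 1" using qD(5) nc qx by simp
    ultimately show False by simp
  qed
  then show ?thesis using p by (intro bexI[of _ p] exI[of _ "2 / r"]) auto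
qed

text \<open>Every directed generating system of seminorms gives the same notion of equicontinuity.\<close>

lemma equicontinuous_family_generating:
  assumes vs: "vector_space smul" and dir: "directed_seminorms smul P"
  shows "equicontinuous_family smul (seminorm_topology P) J S \<longleftrightarrow> equicontinuous_wrt P J S"
proof
  assume L: "equicontinuous_family smul (seminorm_topology P) J S"
  show "equicontinuous_wrt P J S"
    unfolding equicontinuous_wrt_def
  proof
    fix p assume "p \<in> P"
    then obtain q K where q: "q \<in> continuous_seminorms smul (seminorm_topology P)" "K \<ge> 0"
        "\<forall>t\<in>J. \<forall>x. p (S t x) \<le> K * q x"
      using L continuous_seminormI[OF assms] unfolding equicontinuous_family_def equicontinuous_wrt_def
      by blast
    obtain w C where w: "w \<in> P" "C \<ge> 0" "\<forall>x. q x \<le> C * w x"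
      using continuous_seminorm_dominated[OF assms q(1)] by blast
    have "\<forall>t\<in>J. \<forall>x. p (S t x) \<le> (K * C) * w x"
      using q w by (metis mult.assoc mult_left_mono order_trans)
    then show "\<exists>q\<in>P. \<exists>K\<ge>0. \<forall>t\<in>J. \<forall>x. p (S t x) \<le> K * q x"
      using q w by (metis mult_nonneg_nonneg)
  qed
next
  assume R: "equicontinuous_wrt P J S"
  show "equicontinuous_family smul (seminorm_topology P) J S"
    unfolding equicontinuous_family_def equicontinuous_wrt_def
  proof
    fix p assume "p \<in> continuous_seminorms smul (seminorm_topology P)"
    then obtain w C where w: "w \<in> P" "C \<ge> 0" "\<forall>x. p x \<le> C * w x"
      using continuous_seminorm_dominated[OF assms] by blast
    with R obtain q K where q: "q \<in> P" "K \<ge> 0" "\<forall>t\<in>J. \<forall>x. w (S t x) \<le> K * q x"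
      unfolding equicontinuous_wrt_def by blast
    have "\<forall>t\<in>J. \<forall>x. p (S t x) \<le> (C * K) * q x"
      using q w by (metis mult.assoc mult_left_mono order_trans)
    then show "\<exists>q\<in>continuous_seminorms smul (seminorm_topology P). \<exists>K\<ge>0. \<forall>t\<in>J. \<forall>x. p (S t x) \<le> K * q x"
      using q w continuous_seminormI[OF assms] by (metis mult_nonneg_nonneg)
  qed
qed

section \<open>Existence of the mixed topology\<close>

lemma linear_seminorm_topology:
  fixes smul :: "'k::real_normed_field \<Rightarrow> 'a::ab_group_add \<Rightarrow> 'a"
  assumes vs: "vector_space smul" and dir: "directed_seminorms smul P"
  shows "linear_topology smul (seminorm_topology P)"
proof -
  interpret vector_space smul by fact
  let ?T = "seminorm_topology P"
  have sn: "seminorm smul p" if "p \<in> P" for p using dir that by (auto simp: directed_seminorms_def)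
  note sD = seminormD[OF vs sn]
  note top = topspace_seminorm_topology[OF vs dir]
  have "continuous_map (prod_topology ?T ?T) ?T (\<lambda>(x, y). x + y)"
    unfolding continuous_map_seminorm_topology[OF vs dir]
  proof (intro ballI allI impI)
    fix t0 p and r :: real assume p: "p \<in> P" "0 < r"
    obtain x0 y0 :: 'a where t0: "t0 = (x0, y0)" by (cases t0)
    let ?V = "{y. p (y - x0) < r/2} \<times> {y. p (y - y0) < r/2}"
    have "openin (prod_topology ?T ?T) ?V"
      unfolding openin_prod_Times_iff using openin_seminorm_ball[OF vs dir p(1)] by blast
    moreover have "t0 \<in> ?V" using p sD(1)[OF p(1)] t0 by simp
    moreover have "p (x + y - (x0 + y0)) < r" if "p (x - x0) < r/2" "p (y - y0) < r/2" for x y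
      using that sD(4)[OF p(1), of "x - x0" "y - y0"] by (simp add: algebra_simps)
    ultimately show "\<exists>V. openin (prod_topology ?T ?T) V \<and> t0 \<in> V \<and>
        (\<forall>t\<in>V. p ((case t of (x, y) \<Rightarrow> x + y) - (case t0 of (x, y) \<Rightarrow> x + y)) < r)"
      using t0 by (intro exI[of _ ?V]) auto
  qed
  moreover have "continuous_map (prod_topology euclidean ?T) ?T (\<lambda>(c, x). smul c x)"
    unfolding continuous_map_seminorm_topology[OF vs dir]
  proof (intro ballI allI impI)
    fix t0 p and r :: real assume p: "p \<in> P" "0 < r"
    obtain c0 :: 'k and x0 :: 'a where t0: "t0 = (c0, x0)" by (cases t0)
    define d where "d = min 1 (r / (2 * (p x0 + 1)))"
    define e where "e = r / (2 * (norm c0 + 1))"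
    have px0: "p x0 \<ge> 0" using sD(3)[OF p(1)] .
    have d: "d > 0" and e: "e > 0" using p px0 by (auto simp: d_def e_def add_nonneg_pos)
    let ?V = "ball c0 d \<times> {y. p (y - x0) < e}"
    have "openin (prod_topology euclidean ?T) ?V"
      unfolding openin_prod_Times_iff using openin_seminorm_ball[OF vs dir p(1)] by simp
    moreover have "t0 \<in> ?V" using d e sD(1)[OF p(1)] t0 by simp
    moreover have "p (smul c x - smul c0 x0) < r" if c: "dist c0 c < d" and x: "p (x - x0) < e" for c x
    proof -
      have cd: "norm (c - c0) < d" using c by (simp add: dist_norm norm_minus_commute)
      then have c1: "norm c \<le> norm c0 + 1" using norm_triangle_sub[of c c0] by (simp add: d_def)
      have "smul c x - smul c0 x0 = smul c (x - x0) + smul (c - c0) x0"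
        by (simp add: algebra_simps)
      then have "p (smul c x - smul c0 x0) \<le> norm c * p (x - x0) + norm (c - c0) * p x0"
        using sD(4)[OF p(1), of "smul c (x - x0)" "smul (c - c0) x0"] sD(5)[OF p(1)] by simp
      moreover have "norm c * p (x - x0) \<le> (norm c0 + 1) * p (x - x0)"
        using c1 sD(3)[OF p(1)] by (rule mult_right_mono)
      moreover have "(norm c0 + 1) * p (x - x0) < (norm c0 + 1) * e"
        using x by (intro mult_strict_left_mono) (auto simp: add_nonneg_pos)
      moreover have "(norm c0 + 1) * e = r / 2"
      proof -
        have "norm c0 + 1 \<noteq> 0" by (smt (verit) norm_ge_zero)
        then have "e * (norm c0 + 1) = r / 2" unfolding e_def
          by (metis nonzero_mult_divide_mult_cancel_right times_divide_eq_left mult.commute)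
        then show ?thesis by (simp add: mult.commute)
      qed
      moreover have "norm (c - c0) * p x0 \<le> r / (2 * (p x0 + 1)) * p x0"
        using cd px0 by (intro mult_right_mono) (auto simp: d_def)
      moreover have "r / (2 * (p x0 + 1)) * p x0 \<le> r / 2"
        using p px0 by (simp add: field_simps)
      ultimately show ?thesis by linarith
    qed
    ultimately show "\<exists>V. openin (prod_topology euclidean ?T) V \<and> t0 \<in> V \<and>
        (\<forall>t\<in>V. p ((case t of (c, x) \<Rightarrow> smul c x) - (case t0 of (c, x) \<Rightarrow> smul c x)) < r)"
      using t0 by (intro exI[of _ ?V]) auto
  qed
  ultimately show ?thesis using top by (simp add: linear_topology_def)
qed

lemma coarser_antisym: "coarser S T \<Longrightarrow> coarser T S \<Longrightarrow> S = T"
  by (auto simp: topology_eq)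

context saks_space
begin

lemma mixed_topology_exists:
  "\<exists>\<gamma>. mixed_candidate smul \<tau> \<gamma> \<and> (\<forall>\<sigma>. mixed_candidate smul \<tau> \<sigma> \<longrightarrow> coarser \<sigma> \<gamma>)"
proof -
  define \<G> where "\<G> = {U. \<exists>\<sigma>. mixed_candidate smul \<tau> \<sigma> \<and> openin \<sigma> U}"
  define \<gamma> where "\<gamma> = topology_generated_by \<G>"
  have vs: "vector_space smul" ..
  have lin: "linear_topology smul \<tau>"
    unfolding generates by (rule linear_seminorm_topology[OF vs directed])
  have cand: "mixed_candidate smul \<tau> \<tau>"
    using lin coarser_norm by (simp add: mixed_candidate_def)
  have topsp: "topspace \<sigma> = UNIV" if "mixed_candidate smul \<tau> \<sigma>" for \<sigma>
    using that by (simp add: mixed_candidate_def linear_topology_def)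
  have finer: "coarser \<sigma> \<gamma>" if "mixed_candidate smul \<tau> \<sigma>" for \<sigma>
    using that unfolding \<gamma>_def \<G>_def by (blast intro: topology_generated_by_Basis)
  have "openin \<gamma> UNIV" using finer[OF cand] topsp[OF cand] openin_topspace[of \<tau>] by simp
  then have top: "topspace \<gamma> = UNIV" by (metis openin_subset top.extremum_uniqueI)
  have idc: "continuous_map \<gamma> \<sigma> (\<lambda>x. x)" if "mixed_candidate smul \<tau> \<sigma>" for \<sigma>
    using finer[OF that] topsp[OF that] top by (simp add: continuous_map_def)
  have into: "continuous_map Z \<gamma> f"
    if "\<And>\<sigma>. mixed_candidate smul \<tau> \<sigma> \<Longrightarrow> continuous_map Z \<sigma> f" for Z :: "'z topology" and f
    unfolding \<gamma>_def continuous_on_generated_topo_iff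
  proof (intro conjI allI impI)
    fix U assume "U \<in> \<G>"
    then obtain \<sigma> where \<sigma>: "mixed_candidate smul \<tau> \<sigma>" "openin \<sigma> U" by (auto simp: \<G>_def)
    have "openin Z {x \<in> topspace Z. f x \<in> U}"
      by (rule openin_continuous_map_preimage[OF that[OF \<sigma>(1)] \<sigma>(2)])
    then show "openin Z (f -` U \<inter> topspace Z)" by (simp add: vimage_def Int_def conj_commute)
  next
    show "f ` topspace Z \<subseteq> \<Union>\<G>" using top unfolding \<gamma>_def by simp
  qed
  have prod: "continuous_map (prod_topology \<gamma> \<gamma>) \<sigma> (\<lambda>(x, y). x + y)"
    if \<sigma>: "mixed_candidate smul \<tau> \<sigma>" for \<sigma>
  proof -
    have "continuous_map (prod_topology \<gamma> \<gamma>) (prod_topology \<sigma> \<sigma>) (\<lambda>z. (fst z, snd z))"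
      using continuous_map_compose[OF continuous_map_fst idc[OF \<sigma>]]
        continuous_map_compose[OF continuous_map_snd idc[OF \<sigma>]]
      by (intro continuous_map_pairedI) (auto simp: o_def)
    moreover have "continuous_map (prod_topology \<sigma> \<sigma>) \<sigma> (\<lambda>(x, y). x + y)"
      using \<sigma> by (simp add: mixed_candidate_def linear_topology_def)
    ultimately show ?thesis
      by (auto dest: continuous_map_compose simp: o_def case_prod_unfold)
  qed
  have scal: "continuous_map (prod_topology euclidean \<gamma>) \<sigma> (\<lambda>(c, x). smul c x)"
    if \<sigma>: "mixed_candidate smul \<tau> \<sigma>" for \<sigma>
  proof -
    have "continuous_map (prod_topology euclidean \<gamma>) (prod_topology euclidean \<sigma>) (\<lambda>z. (fst z, snd z))"
      using continuous_map_compose[OF continuous_map_snd idc[OF \<sigma>]] continuous_map_fst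
      by (intro continuous_map_pairedI) (auto simp: o_def)
    moreover have "continuous_map (prod_topology euclidean \<sigma>) \<sigma> (\<lambda>(c, x). smul c x)"
      using \<sigma> by (simp add: mixed_candidate_def linear_topology_def)
    ultimately show ?thesis
      by (auto dest: continuous_map_compose simp: o_def case_prod_unfold)
  qed
  have gen: "generate_topology_on \<G> U" if "openin \<gamma> U" for U
    using that by (simp add: \<gamma>_def openin_topology_generated_by_iff)
  have trace: "openin (subtopology \<tau> B) (U \<inter> B)" if "openin \<gamma> U" "bounded B" for U B
    using gen[OF that(1)]
  proof induction
    case Empty
    then show ?case by simp
  next
    case (Int a b)
    then have "openin (subtopology \<tau> B) ((a \<inter> B) \<inter> (b \<inter> B))" by blast
    moreover have "(a \<inter> B) \<inter> (b \<inter> B) = a \<inter> b \<inter> B" by blast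
    ultimately show ?case by simp
  next
    case (UN K)
    then have "openin (subtopology \<tau> B) (\<Union>((\<lambda>k. k \<inter> B) ` K))" by (intro openin_Union) auto
    moreover have "\<Union>((\<lambda>k. k \<inter> B) ` K) = \<Union>K \<inter> B" by blast
    ultimately show ?case by simp
  next
    case (Basis s)
    then obtain \<sigma> where \<sigma>: "mixed_candidate smul \<tau> \<sigma>" "openin \<sigma> s" by (auto simp: \<G>_def)
    then have "subtopology \<sigma> B = subtopology \<tau> B"
      using that(2) by (simp add: mixed_candidate_def)
    moreover have "openin (subtopology \<sigma> B) (s \<inter> B)"
      using \<sigma>(2) by (auto simp: openin_subtopology)
    ultimately show ?case by simp
  qed
  have "subtopology \<gamma> B = subtopology \<tau> B" if "bounded B" for B
  proof (rule coarser_antisym)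
    show "coarser (subtopology \<gamma> B) (subtopology \<tau> B)"
      using trace[OF _ that] unfolding openin_subtopology[of \<gamma>] by blast
    show "coarser (subtopology \<tau> B) (subtopology \<gamma> B)"
      using finer[OF cand] unfolding openin_subtopology by blast
  qed
  moreover have "openin euclidean U" if "openin \<gamma> U" for U
    using gen[OF that] by induction (auto simp: \<G>_def mixed_candidate_def)
  ultimately have "mixed_candidate smul \<tau> \<gamma>"
    using top finer[OF cand] into[OF prod] into[OF scal]
    by (simp add: mixed_candidate_def linear_topology_def)
  then show ?thesis using finer by blast
qed

lemma mixed_topology:
  shows mixed_candidate_mixed_topology: "mixed_candidate smul \<tau> (mixed_topology smul \<tau>)"
    and mixed_topology_finest: "mixed_candidate smul \<tau> \<sigma> \<Longrightarrow> coarser \<sigma> (mixed_topology smul \<tau>)"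
proof -
  have "\<exists>!\<gamma>. mixed_candidate smul \<tau> \<gamma> \<and> (\<forall>\<sigma>. mixed_candidate smul \<tau> \<sigma> \<longrightarrow> coarser \<sigma> \<gamma>)"
    using mixed_topology_exists coarser_antisym by (metis (no_types, lifting))
  from theI'[OF this]
  show "mixed_candidate smul \<tau> (mixed_topology smul \<tau>)"
    and "mixed_candidate smul \<tau> \<sigma> \<Longrightarrow> coarser \<sigma> (mixed_topology smul \<tau>)"
    unfolding mixed_topology_def by blast+
qed

end

section \<open>The range spaces in the definition of \<open>k_lcs_space\<close>\<close>

lemma vector_space_real_restrict:
  fixes smul :: "'k::real_normed_field \<Rightarrow> 'a::ab_group_add \<Rightarrow> 'a"
  assumes "vector_space smul"
  shows "vector_space (\<lambda>r :: real. smul (of_real r))"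
proof -
  interpret vector_space smul by fact
  show ?thesis by standard (simp_all add: scale_right_distrib scale_left_distrib)
qed

lemma k_lcs_spaceD:
  fixes smul :: "'k::real_normed_field \<Rightarrow> 'a::ab_group_add \<Rightarrow> 'a"
    and I :: "'i topology"
  assumes I: "k_lcs_space I" and T: "hausdorff_lcs smul T"
    and f: "\<And>M. compactin I M \<Longrightarrow> continuous_map (subtopology I M) T f"
  shows "continuous_map I T f"
proof -
  define s :: "real \<Rightarrow> 'a \<Rightarrow> 'a" where "s = (\<lambda>r. smul (of_real r))"
  define s' :: "real \<Rightarrow> ('i \<Rightarrow> real) \<Rightarrow> 'i \<Rightarrow> real" where "s' = (\<lambda>r v i. r * v i)"
  from T obtain P where vk: "vector_space smul" and HT: "Hausdorff_space T"
    and dirk: "directed_seminorms smul P" and TP: "T = seminorm_topology P"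
    by (auto simp: hausdorff_lcs_def)
  have vs: "vector_space s" unfolding s_def by (rule vector_space_real_restrict[OF vk])
  have dir: "directed_seminorms s P"
    using dirk by (auto simp: directed_seminorms_def seminorm_def s_def)
  have vs': "vector_space s'"
    by standard (auto simp: s'_def fun_eq_iff algebra_simps)
  interpret V: vector_space s by fact
  interpret W: vector_space s' by fact
  interpret VW: vector_space_pair s s' ..
  have sn: "seminorm s p" if "p \<in> P" for p using dir that by (auto simp: directed_seminorms_def)
  note sD = seminormD[OF vs sn]

  obtain B where B: "B \<subseteq> f ` topspace I" "V.independent B" "f ` topspace I \<subseteq> V.span B"
    using V.maximal_independent_subset[of "f ` topspace I"] by blast
  define E where "E = V.extend_basis B"
  have E: "B \<subseteq> E" "V.independent E" "V.span E = UNIV"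
    using V.extend_basis_superset[OF B(2)] V.independent_extend_basis[OF B(2)]
      V.span_extend_basis[OF B(2)] by (auto simp: E_def)
  define idx where "idx = inv_into (topspace I) f"
  have idx: "idx b \<in> topspace I" "f (idx b) = b" if "b \<in> B" for b
    using B(1) that by (auto simp: idx_def inv_into_into f_inv_into_f subset_iff)
  define J :: "'a \<Rightarrow> 'i \<Rightarrow> real"
    where "J w = (\<lambda>i. if i \<in> idx ` B then V.representation E w (f i) else 0)" for w
  have J: "Vector_Spaces.linear s s' J"
  proof -
    have "J (x + y) = J x + J y" for x y
      using E by (auto simp: J_def fun_eq_iff V.representation_add)
    moreover have "J (s r x) = s' r (J x)" for r x
      using E by (auto simp: J_def s'_def fun_eq_iff V.representation_scale)
    ultimately show ?thesis using vs vs'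
      by (auto simp: Vector_Spaces.linear_def module_hom_def module_hom_axioms_def module_iff_vector_space)
  qed
  interpret J: Vector_Spaces.linear s s' J by fact
  have inj: "inj_on J (V.span B)"
  proof (rule inj_onI)
    fix x y assume xy: "x \<in> V.span B" "y \<in> V.span B" "J x = J y"
    define w where "w = x - y"
    have w: "w \<in> V.span B" using xy by (simp add: w_def V.span_diff)
    have Jw: "J w = 0" using xy by (simp add: w_def J.diff)
    have rep: "V.representation E w = V.representation B w"
      by (rule V.representation_extend[OF E(2) w E(1)])
    have z: "V.representation B w b = 0" for b
    proof (cases "b \<in> B")
      case True
      have "J w (idx b) = V.representation E w b" using True idx(2) by (simp add: J_def)
      then show ?thesis using Jw rep by (simp add: zero_fun_def)
    next
      case False
      then show ?thesis using V.representation_ne_zero by blast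
    qed
    have "w = (\<Sum>b | V.representation B w b \<noteq> 0. s (V.representation B w b) b)"
      using V.sum_nonzero_representation_eq[OF B(2) w] by simp
    then have "w = 0" using z by simp
    then show "x = y" by (simp add: w_def)
  qed
  obtain L where L: "range L \<subseteq> V.span B" "Vector_Spaces.linear s' s L" "\<And>v. v \<in> V.span B \<Longrightarrow> L (J v) = v"
    using VW.linear_exists_left_inverse_on[OF J V.subspace_span inj] by blast
  interpret L: Vector_Spaces.linear s' s L by fact

  define q where "q p F v = p (L v) + (\<Sum>i\<in>F. \<bar>(v - J (L v)) i\<bar>)" for p :: "'a \<Rightarrow> real" and F :: "'i set" and v
  define Q where "Q = {q p F |p F. p \<in> P \<and> finite F}"
  have sub: "(v - w) i = v i - w i" for v w :: "'i \<Rightarrow> real" and i by (simp add: fun_diff_def)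
  have snq: "seminorm s' (q p F)" if p: "p \<in> P" for p F
    unfolding seminorm_def
  proof (intro conjI allI)
    show "0 \<le> q p F x" for x using sD(3)[OF p] by (simp add: q_def sum_nonneg)
    show "q p F (x + y) \<le> q p F x + q p F y" for x y
    proof -
      have "(\<Sum>i\<in>F. \<bar>((x + y) - J (L (x + y))) i\<bar>) \<le> (\<Sum>i\<in>F. \<bar>(x - J (L x)) i\<bar> + \<bar>(y - J (L y)) i\<bar>)"
        by (intro sum_mono) (simp add: L.add J.add sub)
      then show ?thesis using sD(4)[OF p, of "L x" "L y"] by (simp add: q_def L.add sum.distrib)
    qed
    show "q p F (s' c x) = norm c * q p F x" for c x
    proof -
      have "\<bar>(s' c x - J (L (s' c x))) i\<bar> = \<bar>c\<bar> * \<bar>(x - J (L x)) i\<bar>" for i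
        unfolding L.scale J.scale sub by (simp add: s'_def abs_mult[symmetric] algebra_simps)
      then show ?thesis using sD(5)[OF p] by (simp add: q_def L.scale sum_distrib_left distrib_left)
    qed
  qed
  have dirQ: "directed_seminorms s' Q"
    unfolding directed_seminorms_def
  proof (intro conjI ballI)
    obtain p where "p \<in> P" using dir by (auto simp: directed_seminorms_def)
    then have "q p {} \<in> Q" by (auto simp: Q_def)
    then show "Q \<noteq> {}" by blast
    show "seminorm s' w" if "w \<in> Q" for w using that snq by (auto simp: Q_def)
    fix w w' assume "w \<in> Q" "w' \<in> Q"
    then obtain p F p' F' where w: "w = q p F" "w' = q p' F'" "p \<in> P" "p' \<in> P" "finite F" "finite F'"
      by (auto simp: Q_def)
    obtain r C where r: "r \<in> P" "C \<ge> 0" "\<And>x. max (p x) (p' x) \<le> C * r x"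
      using dir w(3,4) unfolding directed_seminorms_def by blast
    have "max (w v) (w' v) \<le> (C + 1) * q r (F \<union> F') v" for v
    proof -
      let ?s = "\<lambda>F. \<Sum>i\<in>F. \<bar>(v - J (L v)) i\<bar>"
      have "?s F \<le> ?s (F \<union> F')" "?s F' \<le> ?s (F \<union> F')"
        using w by (auto intro!: sum_mono2)
      moreover have "0 \<le> C * ?s (F \<union> F')" using r by (simp add: sum_nonneg)
      moreover have "0 \<le> r (L v)" using sD(3)[OF r(1)] .
      ultimately show ?thesis using r(3)[of "L v"] by (simp add: w q_def algebra_simps)
    qed
    moreover have "q r (F \<union> F') \<in> Q" using r w by (auto simp: Q_def)
    ultimately show "\<exists>r\<in>Q. \<exists>C\<ge>0. \<forall>x. max (w x) (w' x) \<le> C * r x"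
      using r(2) by (intro bexI[of _ "q r (F \<union> F')"] exI[of _ "C + 1"]) auto
  qed
  have "Hausdorff_space (seminorm_topology Q)"
    unfolding Hausdorff_space_seminorm_topology[OF vs' dirQ]
  proof (intro allI impI)
    fix v :: "'i \<Rightarrow> real" assume v: "v \<noteq> 0"
    show "\<exists>w\<in>Q. w v \<noteq> 0"
    proof (cases "L v = 0")
      case False
      then obtain p where p: "p \<in> P" "p (L v) \<noteq> 0"
        using HT Hausdorff_space_seminorm_topology[OF vs dir] by (auto simp: TP)
      then show ?thesis by (intro bexI[of _ "q p {}"]) (auto simp: q_def Q_def)
    next
      case True
      from v obtain i where i: "v i \<noteq> 0" by (auto simp: fun_eq_iff)
      from dir obtain p where p: "p \<in> P" by (auto simp: directed_seminorms_def)
      have "q p {i} v = \<bar>v i\<bar>" using True sD(1)[OF p] by (simp add: q_def J.zero sub)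
      then show ?thesis using i p by (intro bexI[of _ "q p {i}"]) (auto simp: Q_def)
    qed
  qed
  then have lcsQ: "hausdorff_lcs s' (seminorm_topology Q)"
    using vs' dirQ by (auto simp: hausdorff_lcs_def)
  have key: "q p F (J (f t) - J (f u)) = p (f t - f u)" if "t \<in> topspace I" "u \<in> topspace I" for p F t u
  proof -
    have "f t - f u \<in> V.span B" using B(3) that by (intro V.span_diff) auto
    then show ?thesis unfolding J.diff[symmetric] by (simp add: q_def L(3) sub)
  qed
  have "continuous_map (subtopology I M) (seminorm_topology Q) (\<lambda>t. J (f t))" if M: "compactin I M" for M
    unfolding continuous_map_seminorm_topology[OF vs' dirQ]
  proof (intro ballI allI impI)
    fix t0 w and r :: real assume A: "t0 \<in> topspace (subtopology I M)" "w \<in> Q" "0 < r"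
    then obtain p F where w: "w = q p F" "p \<in> P" by (auto simp: Q_def)
    note fM = f[OF M, unfolded TP continuous_map_seminorm_topology[OF vs dir], rule_format]
    obtain V where V: "openin (subtopology I M) V" "t0 \<in> V" "\<forall>t\<in>V. p (f t - f t0) < r"
      using fM[OF A(1) w(2) A(3)] by auto
    have "V \<subseteq> topspace I" using openin_subset[OF V(1)] by simp
    then show "\<exists>V. openin (subtopology I M) V \<and> t0 \<in> V \<and> (\<forall>t\<in>V. w (J (f t) - J (f t0)) < r)"
      using V(1,2) A V(3) key w by (intro exI[of _ V]) (simp add: subset_iff)
  qed
  then have cont: "continuous_map I (seminorm_topology Q) (\<lambda>t. J (f t))"
    using conjunct2[OF I[unfolded k_lcs_space_def], rule_format, OF lcsQ, of "\<lambda>t. J (f t)"] by simp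
  show ?thesis
    unfolding TP continuous_map_seminorm_topology[OF vs dir]
  proof (intro ballI allI impI)
    fix t0 p and r :: real assume A: "t0 \<in> topspace I" "p \<in> P" "0 < r"
    then have "q p {} \<in> Q" by (auto simp: Q_def)
    note cQ = cont[unfolded continuous_map_seminorm_topology[OF vs' dirQ], rule_format,
        OF A(1) this A(3)]
    obtain V where V: "openin I V" "t0 \<in> V" "\<forall>t\<in>V. q p {} (J (f t) - J (f t0)) < r"
      using cQ by auto
    have "V \<subseteq> topspace I" using openin_subset[OF V(1)] .
    then show "\<exists>V. openin I V \<and> t0 \<in> V \<and> (\<forall>t\<in>V. p (f t - f t0) < r)"
      using V A(1) key by (intro exI[of _ V]) (simp add: subset_iff)
  qed
qed

end

theory Submission
  imports Defs
begin

text \<open>Let \<open>Q\<close> be the set of seminorms \<open>q\<close> such that for every \<open>\<epsilon> > 0\<close> there are \<open>p \<in> P\<close> and \<open>K\<close> with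
  \<open>q \<le> K p + \<epsilon> \<parallel>\<cdot>\<parallel>\<close>. These are exactly the seminorms that are \<open>\<tau>\<close>-continuous at \<open>0\<close> on bounded sets, and
  they generate the mixed topology. Sets on which all \<open>q \<in> Q\<close> are bounded are norm bounded, so a sequence
  converges in the mixed topology iff it is norm bounded and \<open>\<tau>\<close>-convergent. With this description,
  equitightness of a bounded family says that \<open>sup\<^sub>t q (S t x)\<close> is again in \<open>Q\<close>.
  Under bi-equicontinuity, the convex set \<open>{x. sup\<^sub>t q (S t x) < 1}\<close> is sequentially open.
  For strong Mackey spaces, the functionals \<open>f \<circ> S t\<close> with \<open>\<bar>f\<bar> \<le> q\<close> and \<open>t\<close> in a compact set form a
  weak*-compact set, whose equicontinuity is that of the family \<open>S\<close>.\<close>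

section \<open>Seminorms\<close>

text \<open>The mixed topology is given as the finest linear topology with prescribed traces on
  bounded sets, so neither convexity nor any seminorm comes with it. That \<open>Q\<close> generates
  a topology of this kind is a direct check; the substance is that \<open>Q\<close> is fine enough:
  every neighbourhood of 0 in an arbitrary such topology must contain a ball of some seminorm in
  \<open>Q\<close>. Convexity has to come from \<open>P\<close>, which governs the trace on each
  norm ball, and infimal convolution glues the traces on balls of growing radius into one seminorm.
  The strong Mackey argument asks only that \<open>f \<circ> S t\<close> lie in the dual. Continuity
  of \<open>S t\<close> supplies this, but so does the Mazur property when \<open>S t\<close> is
  known merely to be sequentially continuous, and so one argument serves both (iii) and (iv).
  Equicontinuity over all of \<open>topspace I\<close> forces a uniform norm bound, while
  bi-continuity contains norm bounds on compact sets only; hence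
  \<open>bounded_family (topspace I) S\<close> stands beside \<open>bi_continuous\<close> in the
  first equivalence.\<close>

text \<open>The bound for \<open>inverse c\<close> at the point \<open>smul c x\<close> is the
  reverse inequality. Suprema and infima yield only the upper estimate directly.\<close>

lemma seminormI_le:
  assumes vs: "vector_space smul" and 0: "\<And>x. 0 \<le> p x" and add: "\<And>x y. p (x + y) \<le> p x + p y"
    and le: "\<And>c x. p (smul c x) \<le> norm c * p x"
  shows "seminorm smul p"
  unfolding seminorm_def
proof (intro conjI allI 0 add antisym[OF le])
  interpret vector_space smul by (rule vs)
  show "norm c * p x \<le> p (smul c x)" for c x
  proof (cases "c = 0")
    case False
    have "p x \<le> norm (inverse c) * p (smul c x)" using le[of "inverse c" "smul c x"] False by simp
    then show ?thesis using False by (simp add: norm_inverse norm_divide field_simps)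
  qed (use 0 in simp)
qed

lemma seminorm_SUP:
  assumes vs: "vector_space smul" and "J \<noteq> {}" and r: "\<And>i. i \<in> J \<Longrightarrow> seminorm smul (r i)"
    and bdd: "\<And>x. bdd_above ((\<lambda>i. r i x) ` J)"
  shows "seminorm smul (\<lambda>x. SUP i\<in>J. r i x)"
proof (rule seminormI_le[OF vs])
  note rD = seminormD[OF vs r]
  have upper: "r i x \<le> (SUP i\<in>J. r i x)" if "i \<in> J" for i x using bdd that by (rule cSUP_upper[rotated])
  show nonneg: "0 \<le> (SUP i\<in>J. r i x)" for x
    using assms(2) rD(3) upper by (meson all_not_in_conv order_trans)
  show "(SUP i\<in>J. r i (x + y)) \<le> (SUP i\<in>J. r i x) + (SUP i\<in>J. r i y)" for x y
    by (intro cSUP_least assms(2) order_trans[OF rD(4) add_mono] upper)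
  show "(SUP i\<in>J. r i (smul c x)) \<le> norm c * (SUP i\<in>J. r i x)" for c x
    by (intro cSUP_least assms(2)) (simp add: rD(5) upper mult_left_mono)
qed

lemma seminorm_comp_linear:
  assumes "seminorm smul p" "Vector_Spaces.linear smul smul T"
  shows "seminorm smul (\<lambda>x. p (T x))"
  using assms by (auto simp: seminorm_def Vector_Spaces.linear_iff)

lemma seminorm_le_of_unit_ball:
  fixes smul :: "'k::real_normed_field \<Rightarrow> 'a::ab_group_add \<Rightarrow> 'a"
  assumes vs: "vector_space smul" and p: "seminorm smul p"
    and r: "0 < r" and g: "\<And>c x. g (smul c x) = norm c * g x"
    and ball: "\<And>x. p x < r \<Longrightarrow> g x \<le> 1"
  shows "g x \<le> 2 / r * p x"
proof (rule ccontr)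
  assume n: "\<not> g x \<le> 2 / r * p x"
  note pD = seminormD[OF vs p]
  have gx: "g x > 0" using n pD(3)[of x] r by (smt (verit) divide_nonneg_pos mult_nonneg_nonneg)
  \<comment> \<open>Scaling \<open>g\<close> to the value 2, not 1, contradicts the non-strict bound
    on the ball.\<close>
  define c :: 'k where "c = of_real (2 / g x)"
  have nc: "norm c = 2 / g x" using gx by (simp add: c_def norm_divide)
  have "p (smul c x) = 2 * p x / g x" using pD(5) nc by simp
  also have "\<dots> < r" using n gx r pD(3)[of x] by (simp add: field_simps)
  finally have "g (smul c x) \<le> 1" by (rule ball)
  moreover have "g (smul c x) = 2" using g nc gx by simp
  ultimately show False by simp
qed

lemma limitin_seminorm_topology:
  assumes vs: "vector_space smul" and dir: "directed_seminorms smul P"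
  shows "limitin (seminorm_topology P) u x F \<longleftrightarrow> (\<forall>p\<in>P. \<forall>r>0. \<forall>\<^sub>F n in F. p (u n - x) < r)"
    (is "?L \<longleftrightarrow> ?R")
proof
  have sn: "seminorm smul p" if "p \<in> P" for p using dir that by (auto simp: directed_seminorms_def)
  assume L: ?L
  show ?R
  proof (intro ballI allI impI)
    fix p and r :: real assume p: "p \<in> P" "0 < r"
    have "x \<in> {y. p (y - x) < r}" using p seminormD(1)[OF vs sn[OF p(1)]] by simp
    with L openin_seminorm_ball[OF assms p(1), of x r]
    have "\<forall>\<^sub>F n in F. u n \<in> {y. p (y - x) < r}" unfolding limitin_def by blast
    then show "\<forall>\<^sub>F n in F. p (u n - x) < r" by simp
  qed
next
  assume R: ?R
  show ?L unfolding limitin_def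
  proof (intro conjI allI impI)
    show "x \<in> topspace (seminorm_topology P)" by (simp add: topspace_seminorm_topology[OF assms])
    fix U assume "openin (seminorm_topology P) U \<and> x \<in> U"
    then obtain p r where p: "p \<in> P" "r > 0" "\<And>y. p (y - x) < r \<Longrightarrow> y \<in> U"
      unfolding openin_seminorm_topology[OF assms] by blast
    from R p(1,2) have "\<forall>\<^sub>F n in F. p (u n - x) < r" by blast
    then show "\<forall>\<^sub>F n in F. u n \<in> U" by (rule eventually_mono) (rule p(3))
  qed
qed

section \<open>Infimal convolution\<close>

text \<open>For seminorms \<open>r k\<close> this is the largest seminorm below all of them; its
  open unit ball is the convex hull of their open unit balls.\<close>

definition inf_convolution :: "(nat \<Rightarrow> 'a::ab_group_add \<Rightarrow> real) \<Rightarrow> 'a \<Rightarrow> real"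
  where "inf_convolution r x = Inf {\<Sum>k<n. r k (y k) |n y. (\<Sum>k<n. y k) = x}"

context
  fixes smul :: "'k::real_normed_field \<Rightarrow> 'a::ab_group_add \<Rightarrow> 'a" and r :: "nat \<Rightarrow> 'a \<Rightarrow> real"
  assumes vs: "vector_space smul" and r: "\<And>k. seminorm smul (r k)"
begin

interpretation vector_space smul by (rule vs)

lemmas rD = seminormD[OF vs r]

lemma inf_convolution_le_sum:
  assumes "(\<Sum>k<n. y k) = x"
  shows "inf_convolution r x \<le> (\<Sum>k<n. r k (y k))"
  unfolding inf_convolution_def
  by (rule cInf_lower) (use assms rD(3) in \<open>auto intro!: bdd_belowI[of _ 0] sum_nonneg\<close>)

lemma inf_convolution_le: "inf_convolution r x \<le> r k x"
proof -
  have "inf_convolution r x \<le> (\<Sum>i<Suc k. r i (if i = k then x else 0))"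
    by (rule inf_convolution_le_sum) simp
  also have "(\<Sum>i<Suc k. r i (if i = k then x else 0)) = r k x" using rD(1) by simp
  finally show ?thesis .
qed

lemma inf_convolution_less:
  assumes "inf_convolution r x < c"
  obtains n y where "(\<Sum>k<n. y k) = x" "(\<Sum>k<n. r k (y k)) < c"
proof -
  let ?A = "{\<Sum>k<n. r k (y k) |n y. (\<Sum>k<n. y k) = x}"
  have "(\<Sum>k<1. r k (x :: 'a)) \<in> ?A" by (rule CollectI, rule exI[of _ 1], rule exI[of _ "\<lambda>_. x"]) simp
  then have "?A \<noteq> {}" by blast
  from cInf_lessD[OF this assms[unfolded inf_convolution_def]] show ?thesis using that by blast
qed

lemma inf_convolution_nonneg: "0 \<le> inf_convolution r x"
proof (rule ccontr)
  assume "\<not> 0 \<le> inf_convolution r x"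
  then have "inf_convolution r x < 0" by simp
  then obtain n y where "(\<Sum>k<n. r k (y k)) < 0" by (rule inf_convolution_less)
  then show False using sum_nonneg[of "{..<n}" "\<lambda>k. r k (y k)"] rD(3) by auto
qed

lemma inf_convolution_add: "inf_convolution r (x + x') \<le> inf_convolution r x + inf_convolution r x'"
proof (rule field_le_epsilon)
  fix e :: real assume "0 < e"
  then have e2: "z < z + e/2" for z by simp
  obtain n y where y: "(\<Sum>k<n. y k) = x" "(\<Sum>k<n. r k (y k)) < inf_convolution r x + e/2"
    by (rule inf_convolution_less[OF e2[of "inf_convolution r x"]])
  obtain n' y' where y': "(\<Sum>k<n'. y' k) = x'" "(\<Sum>k<n'. r k (y' k)) < inf_convolution r x' + e/2"
    by (rule inf_convolution_less[OF e2[of "inf_convolution r x'"]])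
  \<comment> \<open>Padding with zeros is free because \<open>r k 0 = 0\<close>, and it lets the two
    nearly optimal decompositions be added term by term.\<close>
  define N where "N = max n n'"
  define z where "z k = (if k < n then y k else 0)" for k
  define z' where "z' k = (if k < n' then y' k else 0)" for k
  have pad: "(\<Sum>k<m. f k) = (\<Sum>k<N. if k < m then f k else 0)" if "m \<le> N"
    for f :: "nat \<Rightarrow> 'b::comm_monoid_add" and m
    using that by (intro sum.mono_neutral_cong_left) auto
  have z: "(\<Sum>k<N. z k) = x" "(\<Sum>k<N. r k (z k)) = (\<Sum>k<n. r k (y k))"
    using y(1) pad[of n y] pad[of n "\<lambda>k. r k (y k)"]
    by (auto simp: z_def N_def rD(1) intro!: sum.cong)
  have z': "(\<Sum>k<N. z' k) = x'" "(\<Sum>k<N. r k (z' k)) = (\<Sum>k<n'. r k (y' k))"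
    using y'(1) pad[of n' y'] pad[of n' "\<lambda>k. r k (y' k)"]
    by (auto simp: z'_def N_def rD(1) intro!: sum.cong)
  have "inf_convolution r (x + x') \<le> (\<Sum>k<N. r k (z k + z' k))"
    using z z' by (intro inf_convolution_le_sum) (simp add: sum.distrib)
  also have "\<dots> \<le> (\<Sum>k<N. r k (z k) + r k (z' k))" by (intro sum_mono rD(4))
  also have "\<dots> \<le> inf_convolution r x + inf_convolution r x' + e"
    using y(2) y'(2) z(2) z'(2) by (simp add: sum.distrib)
  finally show "inf_convolution r (x + x') \<le> inf_convolution r x + inf_convolution r x' + e" .
qed

lemma inf_convolution_scale_le: "inf_convolution r (smul c x) \<le> norm c * inf_convolution r x"
proof (rule field_le_epsilon)
  fix e :: real assume "0 < e"
  define d where "d = e / (norm c + 1)"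
  have "norm c + 1 > 0" by (simp add: add_nonneg_pos)
  then have d: "d > 0" "norm c * d \<le> e" using \<open>0 < e\<close> by (auto simp: d_def field_simps)
  then have "inf_convolution r x < inf_convolution r x + d" by simp
  then obtain n y where y: "(\<Sum>k<n. y k) = x" "(\<Sum>k<n. r k (y k)) < inf_convolution r x + d"
    by (rule inf_convolution_less)
  have "inf_convolution r (smul c x) \<le> (\<Sum>k<n. r k (smul c (y k)))"
    using y(1) by (intro inf_convolution_le_sum) (simp flip: scale_sum_right)
  also have "\<dots> = norm c * (\<Sum>k<n. r k (y k))" using rD(5) by (simp add: sum_distrib_left)
  also have "\<dots> \<le> norm c * (inf_convolution r x + d)" using y(2) by (intro mult_left_mono) auto
  also have "\<dots> \<le> norm c * inf_convolution r x + e" using d(2) by (simp add: algebra_simps)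
  finally show "inf_convolution r (smul c x) \<le> norm c * inf_convolution r x + e" .
qed

lemma seminorm_inf_convolution: "seminorm smul (inf_convolution r)"
  by (rule seminormI_le[OF vs inf_convolution_nonneg inf_convolution_add inf_convolution_scale_le])

end

section \<open>The scalar field\<close>

text \<open>Extracts an imaginary unit with explicit coordinates, so that the isomorphism
  \<open>\<phi>\<close> need not be carried through later proofs.\<close>

lemma real_or_complex_scalars:
  obtains (real) "\<And>c :: 'k::real_or_complex. \<exists>a. c = of_real a"
  | (complex) j :: "'k::real_or_complex" where "j * j = - 1" "\<And>c. \<exists>a b. c = of_real a + of_real b * j"
    "\<And>a b. norm (of_real a + of_real b * j) = sqrt (a\<^sup>2 + b\<^sup>2)"
proof -
  consider
    (r) \<phi> :: "'k::real_or_complex \<Rightarrow> real" where "bij \<phi>" "\<And>x y. \<phi> (x + y) = \<phi> x + \<phi> y" "\<And>x y. \<phi> (x * y) = \<phi> x * \<phi> y"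
      "\<And>r x. \<phi> (r *\<^sub>R x) = r *\<^sub>R \<phi> x" "\<And>x. norm (\<phi> x) = norm x"
  | (c) \<phi> :: "'k::real_or_complex \<Rightarrow> complex" where "bij \<phi>" "\<And>x y. \<phi> (x + y) = \<phi> x + \<phi> y" "\<And>x y. \<phi> (x * y) = \<phi> x * \<phi> y"
      "\<And>r x. \<phi> (r *\<^sub>R x) = r *\<^sub>R \<phi> x" "\<And>x. norm (\<phi> x) = norm x"
    using real_or_complex[where 'a='k] by blast
  then show thesis
  proof cases
    case r
    have inj: "x = y" if "\<phi> x = \<phi> y" for x y using r(1) that by (auto simp: bij_def inj_def)
    \<comment> \<open>\<open>\<phi> 1\<close> is idempotent by multiplicativity, and preservation of
      the norm excludes 0.\<close>
    have "\<phi> 1 \<noteq> 0" using r(5)[of 1] by auto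
    moreover have "\<phi> 1 * \<phi> 1 = \<phi> 1" using r(3)[of 1 1] by simp
    ultimately have one: "\<phi> 1 = 1" by simp
    have "c = of_real (\<phi> c)" for c
      by (rule inj) (simp add: of_real_def r(4) one)
    then show thesis by (intro real) blast
  next
    case c
    have inj: "x = y" if "\<phi> x = \<phi> y" for x y using c(1) that by (auto simp: bij_def inj_def)
    have "\<phi> 1 \<noteq> 0" using c(5)[of 1] by auto
    moreover have "\<phi> 1 * \<phi> 1 = \<phi> 1" using c(3)[of 1 1] by simp
    ultimately have one: "\<phi> 1 = 1" by simp
    have of_real: "\<phi> (of_real r) = of_real r" for r by (simp add: of_real_def c(4) one)
    obtain j where j: "\<phi> j = \<i>" using c(1) by (metis bij_pointE)
    have gen: "\<phi> (of_real a + of_real b * j) = Complex a b" for a b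
      by (simp add: c(2,3) of_real j complex_eq_iff)
    show thesis
    proof (rule complex)
      show "j * j = - 1"
      proof (rule inj)
        have "\<phi> (- 1) = \<phi> (of_real (- 1))" by simp
        also have "\<dots> = - 1" unfolding of_real by simp
        finally show "\<phi> (j * j) = \<phi> (- 1)" by (simp add: c(3) j)
      qed
      show "\<exists>a b. z = of_real a + of_real b * j" for z
        by (rule exI[of _ "Re (\<phi> z)"], rule exI[of _ "Im (\<phi> z)"], rule inj) (simp add: gen)
      show "norm (of_real a + of_real b * j) = sqrt (a\<^sup>2 + b\<^sup>2)" for a b
        unfolding c(5)[symmetric] gen by (simp add: complex_norm)
    qed
  qed
qed

text \<open>Coordinates are bounded by the norm, so the ball is a closed subset of a continuous
  image of a real square. This compactness feeds the Tychonoff argument for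
  \<open>polar\<close>.\<close>

lemma compact_cball_real_or_complex: "compact (cball (0 :: 'k::real_or_complex) r)"
proof -
  have "\<exists>j :: 'k. \<forall>c. \<exists>a b. c = of_real a + of_real b * j \<and> \<bar>a\<bar> \<le> norm c \<and> \<bar>b\<bar> \<le> norm c"
  proof (rule real_or_complex_scalars[where 'k='k])
    assume real: "\<And>c :: 'k. \<exists>a. c = of_real a"
    show ?thesis
    \<comment> \<open>With \<open>j = 0\<close> real scalars fit the same description, which merges
      the two cases.\<close>
    proof (rule exI[of _ 0], rule allI)
      fix c :: 'k
      obtain a where "c = of_real a" using real by blast
      then show "\<exists>a b. c = of_real a + of_real b * 0 \<and> \<bar>a\<bar> \<le> norm c \<and> \<bar>b\<bar> \<le> norm c"
        by (intro exI[of _ a] exI[of _ 0]) simp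
    qed
  next
    fix j :: 'k
    assume "j * j = - 1" and j: "\<And>c. \<exists>a b. c = of_real a + of_real b * j"
      "\<And>a b. norm (of_real a + of_real b * j) = sqrt (a\<^sup>2 + b\<^sup>2)"
    show ?thesis
    proof (rule exI[of _ j], rule allI)
      fix c :: 'k
      obtain a b where c: "c = of_real a + of_real b * j" using j(1) by blast
      then show "\<exists>a b. c = of_real a + of_real b * j \<and> \<bar>a\<bar> \<le> norm c \<and> \<bar>b\<bar> \<le> norm c"
        unfolding c j(2) by (intro exI[of _ a] exI[of _ b]) (simp add: real_le_rsqrt)
    qed
  qed
  then obtain j :: 'k
    where j: "\<And>c. \<exists>a b. c = of_real a + of_real b * j \<and> \<bar>a\<bar> \<le> norm c \<and> \<bar>b\<bar> \<le> norm c" by blast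
  define K where "K = (\<lambda>z. of_real (fst z) + of_real (snd z) * j) ` ({- r..r} \<times> {- r..r})"
  have "compact K" unfolding K_def
    by (intro compact_continuous_image continuous_intros compact_Times) auto
  moreover have "cball 0 r \<subseteq> K"
  proof
    fix c :: 'k assume "c \<in> cball 0 r"
    moreover obtain a b where "c = of_real a + of_real b * j" "\<bar>a\<bar> \<le> norm c" "\<bar>b\<bar> \<le> norm c"
      using j by blast
    ultimately show "c \<in> K" unfolding K_def by (intro image_eqI[of _ _ "(a, b)"]) auto
  qed
  ultimately show ?thesis by (metis closed_cball compact_Int_closed inf.absorb2)
qed

section \<open>The Hahn--Banach theorem\<close>

text \<open>Homogeneity is demanded as an inequality for positive factors, the form that infima
  satisfy at once; \<open>sublinearD\<close> recovers equality by rescaling with the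
  inverse.\<close>

definition sublinear :: "('a::real_vector \<Rightarrow> real) \<Rightarrow> bool"
  where "sublinear p \<longleftrightarrow> (\<forall>x y. p (x + y) \<le> p x + p y) \<and> (\<forall>r>0. \<forall>x. p (r *\<^sub>R x) \<le> r * p x)"

lemma sublinearD:
  assumes "sublinear p"
  shows "p (x + y) \<le> p x + p y" "0 < r \<Longrightarrow> p (r *\<^sub>R x) = r * p x" "p 0 = 0" "- p (- x) \<le> p x"
proof -
  show add: "p (x + y) \<le> p x + p y" for x y using assms by (simp add: sublinear_def)
  show scale: "p (r *\<^sub>R x) = r * p x" if "0 < r" for r x
  proof (rule antisym)
    have "p (inverse r *\<^sub>R (r *\<^sub>R x)) \<le> inverse r * p (r *\<^sub>R x)"
      using assms that unfolding sublinear_def by (metis inverse_positive_iff_positive)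
    then show "r * p x \<le> p (r *\<^sub>R x)" using that by (simp add: field_simps)
  qed (use assms that in \<open>simp add: sublinear_def\<close>)
  show 0: "p 0 = 0" using scale[of 2 0] by simp
  show "- p (- x) \<le> p x" using add[of x "- x"] 0 by simp
qed

text \<open>A minimal sublinear functional \<open>p\<close> coincides with every \<open>ray_reduct p y\<close>, which makes it superadditive
  and hence linear.\<close>

definition ray_reduct :: "('a::real_vector \<Rightarrow> real) \<Rightarrow> 'a \<Rightarrow> 'a \<Rightarrow> real"
  where "ray_reduct p y x = (INF t\<in>{0..}. p (x + t *\<^sub>R y) - t * p y)"

lemma ray_reduct:
  assumes p: "sublinear p"
  shows "0 \<le> t \<Longrightarrow> ray_reduct p y x \<le> p (x + t *\<^sub>R y) - t * p y"
    and "ray_reduct p y x \<le> p x"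
    and "sublinear (ray_reduct p y)"
proof -
  note pD = sublinearD[OF p]
  have scale0: "p (t *\<^sub>R y) = t * p y" if "0 \<le> t" for t
    using pD(2)[of t y] pD(3) that by (cases "t = 0") auto
  \<comment> \<open>A lower bound independent of \<open>t\<close>: the infimum along the ray is
    finite.\<close>
  have "- p (- x) \<le> p (x + t *\<^sub>R y) - t * p y" if "0 \<le> t" for x t
    using pD(1)[of "x + t *\<^sub>R y" "- x"] scale0[OF that] by simp
  then have bdd: "bdd_below ((\<lambda>t. p (x + t *\<^sub>R y) - t * p y) ` {0..})" for x
    by (auto intro!: bdd_belowI[of _ "- p (- x)"])
  show le: "ray_reduct p y x \<le> p (x + t *\<^sub>R y) - t * p y" if "0 \<le> t" for x t
    unfolding ray_reduct_def by (rule cINF_lower[OF bdd]) (use that in simp)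
  show "ray_reduct p y x \<le> p x" using le[of 0 x] by simp
  have greatest: "z \<le> ray_reduct p y x" if "\<And>t. 0 \<le> t \<Longrightarrow> z \<le> p (x + t *\<^sub>R y) - t * p y" for x z
    unfolding ray_reduct_def by (rule cINF_greatest) (use that in auto)
  show "sublinear (ray_reduct p y)"
    unfolding sublinear_def
  proof (intro conjI allI impI)
    fix x x'
    have "ray_reduct p y (x + x') - (p (x' + s *\<^sub>R y) - s * p y) \<le> ray_reduct p y x" if s: "0 \<le> s" for s
    proof (rule greatest)
      fix t :: real assume t: "0 \<le> t"
      have "ray_reduct p y (x + x') \<le> p (x + x' + (t + s) *\<^sub>R y) - (t + s) * p y"
        using s t by (intro le) simp
      also have "x + x' + (t + s) *\<^sub>R y = (x + t *\<^sub>R y) + (x' + s *\<^sub>R y)"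
        by (simp add: scaleR_add_left)
      also have "p ((x + t *\<^sub>R y) + (x' + s *\<^sub>R y)) \<le> p (x + t *\<^sub>R y) + p (x' + s *\<^sub>R y)" by (rule pD(1))
      finally show "ray_reduct p y (x + x') - (p (x' + s *\<^sub>R y) - s * p y) \<le> p (x + t *\<^sub>R y) - t * p y"
        by (simp add: algebra_simps)
    qed
    then have "ray_reduct p y (x + x') - ray_reduct p y x \<le> ray_reduct p y x'"
      by (intro greatest) (simp add: algebra_simps)
    then show "ray_reduct p y (x + x') \<le> ray_reduct p y x + ray_reduct p y x'" by simp
  next
    fix r :: real and x assume r: "0 < r"
    have "ray_reduct p y (r *\<^sub>R x) / r \<le> ray_reduct p y x"
    proof (rule greatest)
      fix t :: real assume t: "0 \<le> t"
      have "ray_reduct p y (r *\<^sub>R x) \<le> p (r *\<^sub>R x + (r * t) *\<^sub>R y) - (r * t) * p y"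
        using r t by (intro le) simp
      also have "r *\<^sub>R x + (r * t) *\<^sub>R y = r *\<^sub>R (x + t *\<^sub>R y)" by (simp add: scaleR_add_right)
      also have "p \<dots> = r * p (x + t *\<^sub>R y)" by (rule pD(2)[OF r])
      finally show "ray_reduct p y (r *\<^sub>R x) / r \<le> p (x + t *\<^sub>R y) - t * p y"
        using r by (simp add: field_simps)
    qed
    then show "ray_reduct p y (r *\<^sub>R x) \<le> r * ray_reduct p y x" using r by (simp add: field_simps)
  qed
qed

text \<open>Provides the lower bounds of chains for Zorn's lemma. The common bound
  \<open>- p (- x)\<close> keeps the infima finite; for subadditivity, two members of the chain are
  replaced by the smaller one.\<close>

lemma sublinear_INF_chain:
  assumes "C \<noteq> {}" and sub: "\<And>f. f \<in> C \<Longrightarrow> sublinear f" and le: "\<And>f x. f \<in> C \<Longrightarrow> f x \<le> p x"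
    and chain: "\<And>f g. f \<in> C \<Longrightarrow> g \<in> C \<Longrightarrow> f \<le> g \<or> g \<le> f"
  shows "sublinear (\<lambda>x. INF f\<in>C. f x)" and "f \<in> C \<Longrightarrow> (INF f\<in>C. f x) \<le> f x"
proof -
  have "- p (- x) \<le> f x" if "f \<in> C" for f x
    using sublinearD(4)[OF sub[OF that], of x] le[OF that, of "- x"] by simp
  then have bdd: "bdd_below ((\<lambda>f. f x) ` C)" for x by (auto intro!: bdd_belowI[of _ "- p (- x)"])
  show lower: "(INF f\<in>C. f x) \<le> f x" if "f \<in> C" for f x by (rule cINF_lower[OF bdd that])
  have greatest: "z \<le> (INF f\<in>C. f x)" if "\<And>f. f \<in> C \<Longrightarrow> z \<le> f x" for x z
    by (rule cINF_greatest) (use assms(1) that in auto)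
  show "sublinear (\<lambda>x. INF f\<in>C. f x)"
    unfolding sublinear_def
  proof (intro conjI allI impI)
    fix x y
    have "(INF f\<in>C. f (x + y)) - g y \<le> (INF f\<in>C. f x)" if g: "g \<in> C" for g
    proof (rule greatest)
      fix f assume f: "f \<in> C"
      obtain h where h: "h \<in> C" "h \<le> f" "h \<le> g" using chain[OF f g] f g by auto
      have "(INF f\<in>C. f (x + y)) \<le> h x + h y"
        using lower[OF h(1)] sublinearD(1)[OF sub[OF h(1)]] by (rule order_trans)
      also have "\<dots> \<le> f x + g y" using h(2,3) by (intro add_mono) (auto simp: le_fun_def)
      finally show "(INF f\<in>C. f (x + y)) - g y \<le> f x" by simp
    qed
    then have "(INF f\<in>C. f (x + y)) - (INF f\<in>C. f x) \<le> (INF f\<in>C. f y)"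
      by (intro greatest) (simp add: algebra_simps)
    then show "(INF f\<in>C. f (x + y)) \<le> (INF f\<in>C. f x) + (INF f\<in>C. f y)" by simp
  next
    fix r :: real and x assume r: "0 < r"
    have "(INF f\<in>C. f (r *\<^sub>R x)) / r \<le> (INF f\<in>C. f x)"
    proof (rule greatest)
      fix f assume f: "f \<in> C"
      have "(INF f\<in>C. f (r *\<^sub>R x)) \<le> r * f x"
        using lower[OF f, of "r *\<^sub>R x"] sublinearD(2)[OF sub[OF f] r] by simp
      then show "(INF f\<in>C. f (r *\<^sub>R x)) / r \<le> f x" using r by (simp add: field_simps)
    qed
    then show "(INF f\<in>C. f (r *\<^sub>R x)) \<le> r * (INF f\<in>C. f x)" using r by (simp add: field_simps)
  qed
qed

lemma linear_below_sublinear: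
  assumes p: "sublinear p"
  shows "\<exists>g. linear g \<and> (\<forall>x. g x \<le> p x)"
proof -
  define A where "A = {h. sublinear h \<and> h \<le> p}"
  have "\<exists>m\<in>A. \<forall>h\<in>A. h \<le> m \<longrightarrow> h = m"
  proof (rule predicate_Zorn)
    \<comment> \<open>The order is reversed, so maximal elements are minimal functionals.\<close>
    show "partial_order_on A (relation_of (\<lambda>m h. h \<le> m) A)"
      by (rule partial_order_on_relation_ofI) auto
    fix C assume C: "C \<in> Chains (relation_of (\<lambda>m h. h \<le> m) A)"
    show "\<exists>u\<in>A. \<forall>a\<in>C. u \<le> a"
    proof (cases "C = {}")
      case True
      then show ?thesis using p by (auto simp: A_def)
    next
      case False
      have CA: "f \<in> A" if "f \<in> C" for f using C that by (auto simp: Chains_def relation_of_def)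
      have chain: "f \<le> g \<or> g \<le> f" if "f \<in> C" "g \<in> C" for f g
        using C that by (auto simp: Chains_def relation_of_def)
      have sub: "sublinear f" and le: "f x \<le> p x" if "f \<in> C" for f x
        using CA[OF that] by (auto simp: A_def le_fun_def)
      have lower: "(\<lambda>x. INF f\<in>C. f x) \<le> f" if "f \<in> C" for f
        by (rule le_funI, rule sublinear_INF_chain(2)[where p = p])
          (use False sub le chain that in auto)
      moreover have "(\<lambda>x. INF f\<in>C. f x) \<in> A"
      proof -
        have "sublinear (\<lambda>x. INF f\<in>C. f x)"
          by (rule sublinear_INF_chain(1)[where p = p]) (use False sub le chain in auto)
        moreover obtain f where "f \<in> C" using False by blast
        then have "(\<lambda>x. INF f\<in>C. f x) \<le> p"
          using lower le by (meson le_funI order_trans)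
        ultimately show ?thesis by (simp add: A_def)
      qed
      ultimately show ?thesis by blast
    qed
  qed
  then obtain m where m: "sublinear m" "m \<le> p" and min: "\<And>h. sublinear h \<Longrightarrow> h \<le> m \<Longrightarrow> h = m"
    unfolding A_def using order_trans by blast
  note mD = sublinearD[OF m(1)]
  have add: "m (x + y) = m x + m y" for x y
  proof (rule antisym[OF mD(1)])
    have "ray_reduct m y = m"
      using ray_reduct[OF m(1)] by (intro min) (auto simp: le_fun_def)
    then show "m x + m y \<le> m (x + y)" using ray_reduct(1)[OF m(1), of 1 y x] by simp
  qed
  have neg: "m (- x) = - m x" for x using add[of x "- x"] mD(3) by simp
  have "linear m"
  proof (rule linearI)
    show "m (r *\<^sub>R x) = r *\<^sub>R m x" for r x
    proof (cases r "0 :: real" rule: linorder_cases)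
      case less
      then have "m ((- r) *\<^sub>R x) = - r * m x" by (intro mD(2)) simp
      then show ?thesis by (simp add: neg)
    qed (use mD(2,3) in auto)
  qed (rule add)
  then show ?thesis using m(2) by (auto simp: le_fun_def)
qed

text \<open>At \<open>- y\<close> the reduct with \<open>t = 1\<close> is at most
  \<open>p 0 - p y\<close>, so a linear functional below the reduct cannot be smaller than
  \<open>p y\<close> at \<open>y\<close>.\<close>

lemma linear_below_sublinear_attaining:
  assumes p: "sublinear p"
  shows "\<exists>g. linear g \<and> (\<forall>x. g x \<le> p x) \<and> g y = p y"
proof -
  obtain g where g: "linear g" "\<And>x. g x \<le> ray_reduct p y x"
    using linear_below_sublinear[OF ray_reduct(3)[OF p]] by blast
  have le: "g x \<le> p x" for x using g(2)[of x] ray_reduct(2)[OF p, of y x] by simp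
  have "g (- y) \<le> - p y"
    using g(2)[of "- y"] ray_reduct(1)[OF p, of 1 y "- y"] sublinearD(3)[OF p] by simp
  then have "p y \<le> g y" using linear_neg[OF g(1)] by simp
  then show ?thesis using g(1) le by (auto intro: antisym)
qed

section \<open>From real functionals to functionals with values in the scalar field\<close>

context normed_space_over
begin

lemma seminorm_sublinear:
  assumes "seminorm smul q"
  shows "sublinear q"
  unfolding sublinear_def
proof (intro conjI allI impI)
  have vs: "vector_space smul" ..
  note qD = seminormD[OF vs assms]
  show "q (x + y) \<le> q x + q y" for x y by (rule qD(4))
  show "q (r *\<^sub>R x) \<le> r * q x" if "0 < r" for r x
    using qD(5)[of "of_real r" x] that by (simp add: scale_of_real)
qed

lemma vector_space_scalars: "vector_space ((*) :: 'k \<Rightarrow> 'k \<Rightarrow> 'k)"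
  by standard (auto simp: algebra_simps)

lemma Hahn_Banach_seminorm:
  assumes q: "seminorm smul q"
  shows "\<exists>f. Vector_Spaces.linear smul (*) f \<and> (\<forall>x. norm (f x) \<le> q x) \<and> q y \<le> norm (f y)"
proof -
  have vs: "vector_space smul" ..
  note qD = seminormD[OF vs q]
  obtain g where g: "linear g" "\<And>x. g x \<le> q x" "g y = q y"
    using linear_below_sublinear_attaining[OF seminorm_sublinear[OF q]] by blast
  note g_simps = linear_add[OF g(1)] linear_cmul[OF g(1)] linear_neg[OF g(1)]
  show ?thesis
  proof (rule real_or_complex_scalars[where 'k='k])
    assume real: "\<And>c :: 'k. \<exists>a. c = of_real a"
    define f where "f x = (of_real (g x) :: 'k)" for x
    have "f (smul c x) = c * f x" for c x
    proof -
      obtain a where "c = of_real a" using real by blast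
      then show ?thesis by (simp add: f_def scale_of_real g_simps)
    qed
    then have "Vector_Spaces.linear smul (*) f"
      unfolding Vector_Spaces.linear_iff using vs vector_space_scalars by (simp add: f_def g_simps)
    moreover have "norm (f x) \<le> q x" for x
      using g(2)[of x] g(2)[of "- x"] qD(2)[of x] by (simp add: f_def g_simps)
    moreover have "q y \<le> norm (f y)" by (simp add: f_def g(3))
    ultimately show ?thesis by blast
  next
    fix j :: 'k
    assume jj: "j * j = - 1" and j: "\<And>c. \<exists>a b. c = of_real a + of_real b * j"
      and norm_j: "\<And>a b. norm (of_real a + of_real b * j) = sqrt (a\<^sup>2 + b\<^sup>2)"
    have re_le: "\<bar>a\<bar> \<le> norm (of_real a + of_real b * j)" for a b
      unfolding norm_j by (simp add: real_le_rsqrt)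
    have re_eq: "a = c" if "of_real a + of_real b * j = of_real c" for a b c
    proof -
      have "of_real (a - c) + of_real b * j = 0" using that by (simp add: algebra_simps)
      then show ?thesis using re_le[of "a - c" b] by simp
    qed
    \<comment> \<open>The coefficient of \<open>j\<close> is forced by the requirement
      \<open>f (smul j x) = j * f x\<close>.\<close>
    define f where "f x = of_real (g x) + of_real (- g (smul j x)) * j" for x
    have f_real: "f (smul (of_real a) x) = of_real a * f x" for a x
    proof -
      have "smul j (a *\<^sub>R x) = a *\<^sub>R smul j x" by (simp add: mult.commute flip: scale_of_real)
      then show ?thesis by (simp add: f_def scale_of_real g_simps right_diff_distrib mult.assoc)
    qed
    have f_j: "f (smul j x) = j * f x" for x
    proof -
      have "smul j (smul j x) = - x" by (simp add: jj)
      moreover have "j * (of_real b * j) = - of_real b" for b :: real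
        using jj by (metis mult.left_commute mult_minus1_right)
      ultimately show ?thesis by (simp add: f_def g_simps right_diff_distrib mult.commute)
    qed
    have f_add: "f (x + x') = f x + f x'" for x x'
      by (simp add: f_def scale_right_distrib g_simps algebra_simps)
    have f_scale: "f (smul c x) = c * f x" for c x
    proof -
      obtain a b where c: "c = of_real a + of_real b * j" using j by blast
      have "smul c x = smul (of_real a) x + smul (of_real b) (smul j x)"
        by (simp add: c scale_left_distrib)
      then show ?thesis by (simp only: f_add f_real f_j) (simp add: c algebra_simps)
    qed
    have "norm (f x) \<le> q x" for x
    proof (cases "f x = 0")
      case True
      then show ?thesis using qD(3) by simp
    next
      case False
      \<comment> \<open>A factor of norm 1 rotating \<open>f x\<close> to the positive real axis,
        where \<open>f\<close> and \<open>g\<close> agree; the bound for \<open>g\<close> thus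
        transfers without a constant.\<close>
      define c where "c = of_real (norm (f x)) / f x"
      have nc: "norm c = 1" using False by (simp add: c_def norm_divide)
      have "f (smul c x) = of_real (norm (f x))" using False by (simp add: f_scale c_def)
      then have "g (smul c x) = norm (f x)" unfolding f_def[of "smul c x"] by (rule re_eq)
      then show ?thesis using g(2)[of "smul c x"] qD(5)[of c x] nc by simp
    qed
    moreover have "q y \<le> norm (f y)" using re_le[of "g y" "- g (smul j y)"] g(3) by (simp add: f_def)
    moreover have "Vector_Spaces.linear smul (*) f"
      unfolding Vector_Spaces.linear_iff using vs vector_space_scalars f_add f_scale by simp
    ultimately show ?thesis by blast
  qed
qed

section \<open>Strong Mackey spaces\<close>

text \<open>For a seminorm \<open>q\<close>, the polar of its closed unit ball. All conditions
  survive pointwise limits; continuity of the members follows from the bound in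
  \<open>polar_subset_dual\<close>.\<close>

definition polar :: "('a \<Rightarrow> real) \<Rightarrow> ('a \<Rightarrow> 'k) set"
  where "polar q = {f. Vector_Spaces.linear smul (*) f \<and> (\<forall>x. norm (f x) \<le> q x)}"

text \<open>Alaoglu's theorem: the product of the balls of radius \<open>q x\<close> is compact by
  Tychonoff's theorem, and each condition is closed because it involves finitely many
  evaluations.\<close>

lemma compactin_polar: "compactin (product_topology (\<lambda>_. euclidean) UNIV) (polar q)"
proof (rule closed_compactin)
  let ?\<Pi> = "product_topology (\<lambda>_ :: 'a. euclidean :: 'k topology) UNIV"
  show "compactin ?\<Pi> (PiE UNIV (\<lambda>x. cball 0 (q x)))"
    by (simp add: compactin_PiE compact_cball_real_or_complex)
  show "polar q \<subseteq> PiE UNIV (\<lambda>x. cball 0 (q x))" by (auto simp: polar_def)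
  have ev: "continuous_map ?\<Pi> euclidean (\<lambda>f. f x)" for x
    by (rule continuous_map_product_projection) simp
  have 1: "closedin ?\<Pi> {f. f (x + y) = f x + f y}" for x y
    using closedin_continuous_maps_eq[OF _ ev continuous_map_add[OF ev ev], of "x + y" x y] by simp
  have 2: "closedin ?\<Pi> {f. f (smul c x) = c * f x}" for c x
  proof -
    have "continuous_map ?\<Pi> euclidean ((\<lambda>z. c * z) \<circ> (\<lambda>f. f x))"
      by (rule continuous_map_compose[OF ev]) (auto intro: continuous_intros)
    then show ?thesis
      using closedin_continuous_maps_eq[OF _ ev, of "\<lambda>f. c * f x" "smul c x"] by (simp add: o_def)
  qed
  have 3: "closedin ?\<Pi> {f. norm (f x) \<le> q x}" for x
  proof -
    have "closedin ?\<Pi> {f \<in> topspace ?\<Pi>. f x \<in> cball 0 (q x)}"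
      by (rule closedin_continuous_map_preimage[OF ev]) simp
    then show ?thesis by simp
  qed
  have "polar q = (\<Inter>x. \<Inter>y. {f. f (x + y) = f x + f y}) \<inter>
      (\<Inter>c. \<Inter>x. {f. f (smul c x) = c * f x}) \<inter> (\<Inter>x. {f. norm (f x) \<le> q x})"
    using vector_space_axioms vector_space_scalars by (auto simp: polar_def Vector_Spaces.linear_iff)
  moreover have "closedin ?\<Pi> ((\<Inter>x. \<Inter>y. {f. f (x + y) = f x + f y}) \<inter>
      (\<Inter>c. \<Inter>x. {f. f (smul c x) = c * f x}) \<inter> (\<Inter>x. {f. norm (f x) \<le> q x}))"
    using 1 2 3 by (intro closedin_Int closedin_INT) auto
  ultimately show "closedin ?\<Pi> (polar q)" by simp
qed

lemma polar_subset_dual: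
  assumes dir: "directed_seminorms smul Q" and q: "q \<in> Q"
  shows "polar q \<subseteq> dual smul (seminorm_topology Q)"
proof
  fix f assume f: "f \<in> polar q"
  have vs: "vector_space smul" ..
  have lin: "Vector_Spaces.linear smul (*) f" using f by (simp add: polar_def)
  interpret f: Vector_Spaces.linear smul "(*)" f by (rule lin)
  have sn: "seminorm smul q" using dir q by (auto simp: directed_seminorms_def)
  have "continuous_map (seminorm_topology Q) Met_TC.mtopology f"
    unfolding Met_TC.continuous_map_to_metric
  proof (intro ballI allI impI)
    fix x and e :: real assume e: "0 < e"
    have "dist (f x) (f y) < e" if "q (y - x) < e" for y
    proof -
      have "norm (f (y - x)) \<le> q (y - x)" using f by (simp add: polar_def)
      also note that
      finally show ?thesis by (simp add: f.diff dist_norm norm_minus_commute)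
    qed
    then show "\<exists>U. openin (seminorm_topology Q) U \<and> x \<in> U \<and> (\<forall>y\<in>U. f y \<in> Met_TC.mball (f x) e)"
      using openin_seminorm_ball[OF vs dir q, of x e] e seminormD(1)[OF vs sn]
      by (intro exI[of _ "{y. q (y - x) < e}"]) auto
  qed
  then show "f \<in> dual smul (seminorm_topology Q)" using lin by (simp add: dual_def)
qed

text \<open>By the Alaoglu theorem and joint continuity of \<open>(f, t) \<mapsto> f \<circ> S t\<close>, the set of all \<open>f \<circ> S t\<close> with
  \<open>\<bar>f\<bar> \<le> q\<close> and \<open>t \<in> M\<close> is weak*-compact. By the Hahn--Banach theorem, \<open>q\<close> is the supremum of these
  \<open>\<bar>f\<bar>\<close>, so that equicontinuity of this set bounds \<open>q \<circ> S t\<close>.\<close>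

lemma strong_Mackey_equicontinuous:
  assumes dir: "directed_seminorms smul Q"
    and Mackey: "strong_Mackey smul (seminorm_topology Q)"
    and M: "compactin I M"
    and strong: "strongly_continuous I (seminorm_topology Q) S"
    and dual: "\<And>t f. t \<in> M \<Longrightarrow> f \<in> dual smul (seminorm_topology Q) \<Longrightarrow>
      f \<circ> S t \<in> dual smul (seminorm_topology Q)"
  shows "equicontinuous_family smul (seminorm_topology Q) M S"
proof -
  have vs: "vector_space smul" ..
  let ?T = "seminorm_topology Q"
  let ?\<Pi> = "product_topology (\<lambda>_ :: 'a. euclidean :: 'k topology) UNIV"
  have MI: "M \<subseteq> topspace I" using compactin_subset_topspace[OF M] .
  have "\<exists>w\<in>continuous_seminorms smul ?T. \<exists>K\<ge>0. \<forall>t\<in>M. \<forall>x. q (S t x) \<le> K * w x" if q: "q \<in> Q" for q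
  proof -
    have sn: "seminorm smul q" using dir q by (auto simp: directed_seminorms_def)
    note qD = seminormD[OF vs sn]
    let ?Z = "prod_topology (subtopology ?\<Pi> (polar q)) (subtopology I M)"
    define F where "F = (\<lambda>(f, t). f \<circ> S t) ` (polar q \<times> M)"
    have "continuous_map ?Z Met_TC.mtopology (\<lambda>z. fst z (S (snd z) x))" for x
      unfolding Met_TC.continuous_map_to_metric
    proof (intro ballI allI impI)
      fix z and e :: real assume z: "z \<in> topspace ?Z" and e: "0 < e"
      obtain f0 t0 where z0: "z = (f0, t0)" by (cases z)
      have f0: "f0 \<in> polar q" and t0: "t0 \<in> M" using z z0 by auto
      \<comment> \<open>\<open>U\<close> controls the change of the functional at the fixed vector
        \<open>S t0 x\<close>, and \<open>V\<close> the change of the vector. The latter is uniform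
        in the functional, since all members of the polar are dominated by \<open>q\<close>.\<close>
      define U where "U = {f \<in> topspace (subtopology ?\<Pi> (polar q)). f (S t0 x) \<in> ball (f0 (S t0 x)) (e/2)}"
      define V where "V = {t \<in> topspace (subtopology I M). S t x \<in> {y. q (y - S t0 x) < e/2}}"
      have "continuous_map (subtopology ?\<Pi> (polar q)) euclidean (\<lambda>f. f (S t0 x))"
        by (rule continuous_map_from_subtopology[OF continuous_map_product_projection]) simp
      then have U: "openin (subtopology ?\<Pi> (polar q)) U"
        unfolding U_def by (rule openin_continuous_map_preimage) simp
      have "continuous_map (subtopology I M) ?T (\<lambda>t. S t x)"
        using strong by (auto simp: strongly_continuous_def intro: continuous_map_from_subtopology)
      then have V: "openin (subtopology I M) V"
        unfolding V_def by (rule openin_continuous_map_preimage) (rule openin_seminorm_ball[OF vs dir q])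
      have "dist (f0 (S t0 x)) (f (S t x)) < e" if "f \<in> U" "t \<in> V" for f t
      proof -
        have f: "f \<in> polar q" and fd: "dist (f0 (S t0 x)) (f (S t0 x)) < e/2"
          and td: "q (S t x - S t0 x) < e/2" using that by (auto simp: U_def V_def)
        interpret f: Vector_Spaces.linear smul "(*)" f using f by (simp add: polar_def)
        have "dist (f (S t0 x)) (f (S t x)) = norm (f (S t x - S t0 x))"
          by (simp add: f.diff dist_norm norm_minus_commute)
        also have "\<dots> \<le> q (S t x - S t0 x)" using f by (simp add: polar_def)
        also note td
        finally show ?thesis using fd dist_triangle[of "f0 (S t0 x)" "f (S t x)" "f (S t0 x)"] by simp
      qed
      moreover have "z \<in> U \<times> V" using f0 t0 MI e qD(1) by (auto simp: z0 U_def V_def)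
      moreover have "openin ?Z (U \<times> V)" using U V by (simp add: openin_prod_Times_iff)
      ultimately show "\<exists>W. openin ?Z W \<and> z \<in> W \<and>
          (\<forall>y\<in>W. fst y (S (snd y) x) \<in> Met_TC.mball (fst z (S (snd z) x)) e)"
        by (intro exI[of _ "U \<times> V"]) (auto simp: z0)
    qed
    then have "continuous_map ?Z ?\<Pi> (\<lambda>(f, t). f \<circ> S t)"
      by (simp add: continuous_map_componentwise_UNIV case_prod_unfold)
    moreover have "compactin ?Z (polar q \<times> M)"
      using compactin_polar M by (simp add: compactin_Times compactin_subtopology)
    ultimately have "compactin ?\<Pi> F" unfolding F_def by (rule image_compactin[rotated])
    moreover have "F \<subseteq> dual smul ?T"
      using dual polar_subset_dual[OF dir q] by (auto simp: F_def)
    ultimately have "compactin (weak_star smul ?T) F" by (simp add: weak_star_def compactin_subtopology)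
    then obtain w K where w: "w \<in> continuous_seminorms smul ?T" "K \<ge> 0" "\<And>f x. f \<in> F \<Longrightarrow> norm (f x) \<le> K * w x"
      using Mackey unfolding strong_Mackey_def by meson
    have "q (S t x) \<le> K * w x" if t: "t \<in> M" for t x
    proof -
      obtain f where f: "f \<in> polar q" "q (S t x) \<le> norm (f (S t x))"
        using Hahn_Banach_seminorm[OF sn, of "S t x"] by (auto simp: polar_def)
      have "f \<circ> S t \<in> F" using f(1) t by (auto simp: F_def)
      from w(3)[OF this, of x] f(2) show ?thesis by simp
    qed
    then show ?thesis using w(1,2) by blast
  qed
  then have "\<exists>w\<in>Q. \<exists>K\<ge>0. \<forall>t\<in>M. \<forall>x. q (S t x) \<le> K * w x" if q: "q \<in> Q" for q
  proof -
    obtain w K where w: "w \<in> continuous_seminorms smul ?T" "K \<ge> 0" "\<forall>t\<in>M. \<forall>x. q (S t x) \<le> K * w x"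
      using \<open>\<And>q. q \<in> Q \<Longrightarrow> _\<close>[OF q] by blast
    obtain v C where v: "v \<in> Q" "C \<ge> 0" "\<forall>x. w x \<le> C * v x"
      using continuous_seminorm_dominated[OF vs dir w(1)] by blast
    have "\<forall>t\<in>M. \<forall>x. q (S t x) \<le> (K * C) * v x"
      using w v by (metis mult.assoc mult_left_mono order_trans)
    then show ?thesis using v(1,2) w(2) by (metis mult_nonneg_nonneg)
  qed
  then show ?thesis
    unfolding equicontinuous_family_generating[OF vs dir] equicontinuous_wrt_def by blast
qed

end

section \<open>Uniform boundedness\<close>

lemma bounded_family_bound:
  assumes "\<And>t. t \<in> J \<Longrightarrow> bounded_linear (S t)"
  shows "bounded_family J S \<longleftrightarrow> (\<exists>C\<ge>0. \<forall>t\<in>J. \<forall>x. norm (S t x) \<le> C * norm x)"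
proof
  assume "bounded_family J S"
  then obtain C where C: "\<And>t. t \<in> J \<Longrightarrow> onorm (S t) \<le> C" by (auto simp: bounded_family_def bdd_above_def)
  have "norm (S t x) \<le> \<bar>C\<bar> * norm x" if "t \<in> J" for t x
  proof -
    have "onorm (S t) * norm x \<le> \<bar>C\<bar> * norm x" using C[OF that] by (intro mult_right_mono) auto
    then show ?thesis using onorm[OF assms[OF that], of x] by simp
  qed
  then show "\<exists>C\<ge>0. \<forall>t\<in>J. \<forall>x. norm (S t x) \<le> C * norm x" by (intro exI[of _ "\<bar>C\<bar>"]) simp
next
  assume "\<exists>C\<ge>0. \<forall>t\<in>J. \<forall>x. norm (S t x) \<le> C * norm x"
  then obtain C where C: "0 \<le> C" "\<And>t x. t \<in> J \<Longrightarrow> norm (S t x) \<le> C * norm x" by blast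
  show "bounded_family J S"
    unfolding bounded_family_def by (rule bdd_aboveI2[of _ _ C], rule onorm_bound) (use C in auto)
qed

text \<open>By Baire's theorem one of the closed level sets \<open>A n\<close>, which cover the
  space, has interior points. Differences of points of a ball inside it reach every direction,
  whence the constant \<open>2 * n / r\<close>.\<close>

lemma uniform_boundedness:
  fixes T :: "'i \<Rightarrow> 'a::real_normed_vector \<Rightarrow> 'b::real_normed_vector"
  assumes complete: "complete (UNIV :: 'a set)" and T: "\<And>t. t \<in> J \<Longrightarrow> bounded_linear (T t)"
    and bdd: "\<And>x. bounded ((\<lambda>t. T t x) ` J)"
  shows "\<exists>C\<ge>0. \<forall>t\<in>J. \<forall>x. norm (T t x) \<le> C * norm x"
proof -
  define A where "A n = (\<Inter>t\<in>J. {x. norm (T t x) \<le> real n})" for n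
  have closed: "closed (A n)" for n
    unfolding A_def
    by (intro closed_INT ballI closed_Collect_le continuous_intros linear_continuous_on T)
  have "x \<in> (\<Union>n. A n)" for x
  proof -
    obtain b where b: "\<And>t. t \<in> J \<Longrightarrow> norm (T t x) \<le> b" using bdd[of x] by (auto simp: bounded_iff)
    obtain n where "b \<le> real n" using real_arch_simple by blast
    then have "x \<in> A n" using b by (force simp: A_def)
    then show ?thesis by blast
  qed
  then have "\<Union>(range A) = UNIV" by blast
  moreover have "interior (\<Union>(range A)) = {}" if "\<And>n. interior (A n) = {}"
    using Met_TC.metric_Baire_category_alt[of "range A"] complete closed that by auto
  ultimately have "\<exists>n. interior (A n) \<noteq> {}" by auto
  then obtain n x where "x \<in> interior (A n)" by blast
  then obtain r where r: "0 < r" "cball x r \<subseteq> A n" by (meson mem_interior_cball)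
  have "norm (T t y) \<le> 2 * real n / r * norm y" if t: "t \<in> J" for t y
  proof (cases "y = 0")
    case False
    interpret bounded_linear "T t" by (rule T[OF t])
    define z where "z = (r / norm y) *\<^sub>R y"
    have "x + z \<in> A n" "x \<in> A n" using r False by (auto simp: z_def subset_iff dist_norm)
    then have "norm (T t (x + z)) \<le> n" "norm (T t x) \<le> n" using t by (auto simp: A_def)
    then have "norm (T t z) \<le> 2 * real n"
      using norm_triangle_ineq4[of "T t (x + z)" "T t x"] by (simp add: add)
    then show ?thesis using r(1) False by (simp add: z_def scaleR field_simps)
  next
    case True
    then show ?thesis using linear_0[OF bounded_linear.linear[OF T[OF t]]] by simp
  qed
  then show ?thesis using r(1) by (intro exI[of _ "2 * real n / r"]) simp
qed

section \<open>The seminorms of the mixed topology\<close>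

context saks_space
begin

lemma vs: "vector_space smul" ..

lemma P_seminorm: "p \<in> P \<Longrightarrow> seminorm smul p"
  using directed by (auto simp: directed_seminorms_def)

lemmas PD = seminormD[OF vs P_seminorm]

lemma P_le_norm: "p \<in> P \<Longrightarrow> p x \<le> norm x"
  unfolding norm_eq_SUP using bounded_above by (rule cSUP_upper[rotated])

lemma P_nonempty: "P \<noteq> {}" using directed by (auto simp: directed_seminorms_def)

lemma less_norm_P: "c < norm x \<Longrightarrow> \<exists>p\<in>P. c < p x"
  unfolding norm_eq_SUP using less_cSUP_iff[OF P_nonempty bounded_above] by blast

definition mixed_seminorms :: "('a \<Rightarrow> real) set"
  where "mixed_seminorms =
    {q. seminorm smul q \<and> (\<forall>\<epsilon>>0. \<exists>p\<in>P. \<exists>K\<ge>0. \<forall>x. q x \<le> K * p x + \<epsilon> * norm x)}"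

lemma mixed_seminorm: "q \<in> mixed_seminorms \<Longrightarrow> seminorm smul q"
  by (simp add: mixed_seminorms_def)

lemmas mixedD = seminormD[OF vs mixed_seminorm]

lemma mixed_seminorms_bound:
  assumes "q \<in> mixed_seminorms" "0 < \<epsilon>"
  obtains p K where "p \<in> P" "0 \<le> K" "\<And>x. q x \<le> K * p x + \<epsilon> * norm x"
  using assms unfolding mixed_seminorms_def by blast

lemma P_subset_mixed: "P \<subseteq> mixed_seminorms"
proof
  fix p assume p: "p \<in> P"
  have "p x \<le> 1 * p x + \<epsilon> * norm x" if "\<epsilon> > 0" for \<epsilon> x using that by simp
  then show "p \<in> mixed_seminorms"
    unfolding mixed_seminorms_def using p P_seminorm by (blast intro: zero_le_one)
qed

lemma mixed_le_norm:
  assumes "q \<in> mixed_seminorms"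
  obtains C where "0 < C" "\<And>x. q x \<le> C * norm x"
proof -
  obtain p K where p: "p \<in> P" "0 \<le> K" "\<And>x. q x \<le> K * p x + 1 * norm x"
    using mixed_seminorms_bound[OF assms zero_less_one] by blast
  have "q x \<le> (K + 1) * norm x" for x
    using p(3)[of x] mult_left_mono[OF P_le_norm[OF p(1), of x] p(2)] by (simp add: algebra_simps)
  then show ?thesis using that[of "K + 1"] p(2) by simp
qed

text \<open>The working form of the \<open>\<epsilon>\<close> estimate: on a norm ball the norm term
  takes up half of \<open>e\<close>, and a single \<open>p\<close> controls the rest.\<close>

lemma mixed_small:
  assumes "q \<in> mixed_seminorms" "0 < e"
  obtains p d where "p \<in> P" "0 < d" "\<And>x. norm x \<le> b \<Longrightarrow> p x < d \<Longrightarrow> q x < e"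
proof -
  \<comment> \<open>\<open>\<bar>b\<bar> + 1\<close> keeps the denominator positive for every real
    \<open>b\<close>.\<close>
  define \<epsilon> where "\<epsilon> = e / (2 * (\<bar>b\<bar> + 1))"
  have \<epsilon>: "\<epsilon> > 0" using assms by (simp add: \<epsilon>_def)
  obtain p K where p: "p \<in> P" "0 \<le> K" "\<And>x. q x \<le> K * p x + \<epsilon> * norm x"
    using mixed_seminorms_bound[OF assms(1) \<epsilon>] by blast
  define d where "d = e / 2 / (K + 1)"
  have d: "d > 0" using assms p by (simp add: d_def)
  have "q x < e" if x: "norm x \<le> b" "p x < d" for x
  proof -
    have "K * p x \<le> K * d" using x p(2) by (intro mult_left_mono) auto
    also have "K * d < (K + 1) * d" using d by simp
    also have "(K + 1) * d = e / 2"
    proof -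
      have "K + 1 \<noteq> 0" using p(2) by linarith
      then show ?thesis unfolding d_def by (simp add: divide_simps)
    qed
    finally have "K * p x < e / 2" .
    moreover have "\<epsilon> * norm x \<le> \<epsilon> * (\<bar>b\<bar> + 1)" using x \<epsilon> by (intro mult_left_mono) auto
    moreover have "\<epsilon> * (\<bar>b\<bar> + 1) = e / 2"
    proof -
      have "\<bar>b\<bar> + 1 \<noteq> 0" by linarith
      then show ?thesis unfolding \<epsilon>_def by (simp add: divide_simps)
    qed
    ultimately show ?thesis using p(3)[of x] by linarith
  qed
  then show ?thesis using that p(1) d by blast
qed

lemma mixed_seminorms_directed: "directed_seminorms smul mixed_seminorms"
  unfolding directed_seminorms_def
proof (intro conjI ballI)
  show "mixed_seminorms \<noteq> {}" using P_nonempty P_subset_mixed by blast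
  show "seminorm smul p" if "p \<in> mixed_seminorms" for p using that by (rule mixed_seminorm)
  fix q q' assume q: "q \<in> mixed_seminorms" and q': "q' \<in> mixed_seminorms"
  define s where "s x = q x + q' x" for x
  have "seminorm smul s"
    unfolding seminorm_def s_def
    using mixedD(3,4,5)[OF q] mixedD(3,4,5)[OF q']
    by (auto simp: distrib_left) (smt (verit))
  moreover have "\<exists>p\<in>P. \<exists>K\<ge>0. \<forall>x. s x \<le> K * p x + \<epsilon> * norm x" if "\<epsilon> > 0" for \<epsilon>
  proof -
    have "\<epsilon> / 2 > 0" using that by simp
    obtain p K where p: "p \<in> P" "0 \<le> K" "\<And>x. q x \<le> K * p x + \<epsilon>/2 * norm x"
      using mixed_seminorms_bound[OF q \<open>\<epsilon> / 2 > 0\<close>] by blast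
    obtain p' K' where p': "p' \<in> P" "0 \<le> K'" "\<And>x. q' x \<le> K' * p' x + \<epsilon>/2 * norm x"
      using mixed_seminorms_bound[OF q' \<open>\<epsilon> / 2 > 0\<close>] by blast
    obtain w C where w: "w \<in> P" "C \<ge> 0" "\<And>x. max (p x) (p' x) \<le> C * w x"
      using directed p(1) p'(1) unfolding directed_seminorms_def by blast
    have "s x \<le> (K * C + K' * C) * w x + \<epsilon> * norm x" for x
    proof -
      have "K * p x \<le> K * (C * w x)" "K' * p' x \<le> K' * (C * w x)"
        using w(3)[of x] p(2) p'(2) by (auto intro: mult_left_mono)
      then show ?thesis using p(3)[of x] p'(3)[of x] by (simp add: s_def algebra_simps)
    qed
    moreover have "0 \<le> K * C + K' * C" using p p' w by simp
    ultimately show ?thesis using w(1) by blast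
  qed
  ultimately have "s \<in> mixed_seminorms" by (simp add: mixed_seminorms_def)
  moreover have "max (q x) (q' x) \<le> 1 * s x" for x
    using mixedD(3)[OF q] mixedD(3)[OF q'] by (simp add: s_def)
  ultimately show "\<exists>r\<in>mixed_seminorms. \<exists>C\<ge>0. \<forall>x. max (q x) (q' x) \<le> C * r x"
    by (blast intro: zero_le_one)
qed

section \<open>The mixed seminorms generate the mixed topology\<close>

lemmas openin_mixed_seminorms = openin_seminorm_topology[OF vs mixed_seminorms_directed]

lemma openin_tau: "openin \<tau> U \<longleftrightarrow> (\<forall>x\<in>U. \<exists>p\<in>P. \<exists>r>0. \<forall>y. p (y - x) < r \<longrightarrow> y \<in> U)"
  unfolding generates by (rule openin_seminorm_topology[OF vs directed])

lemma openin_mixed_seminormsD: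
  assumes "openin (seminorm_topology mixed_seminorms) U" "x \<in> U"
  obtains q r where "q \<in> mixed_seminorms" "0 < r" "\<And>y. q (y - x) < r \<Longrightarrow> y \<in> U"
  using assms unfolding openin_mixed_seminorms by meson

lemma topspace_tau: "topspace \<tau> = UNIV"
  unfolding generates by (rule topspace_seminorm_topology[OF vs directed])

lemma mixed_candidate_seminorms: "mixed_candidate smul \<tau> (seminorm_topology mixed_seminorms)"
  unfolding mixed_candidate_def
proof (intro conjI allI impI)
  let ?T = "seminorm_topology mixed_seminorms"
  show "linear_topology smul ?T" by (rule linear_seminorm_topology[OF vs mixed_seminorms_directed])
  show finer: "openin ?T U" if "openin \<tau> U" for U
    unfolding openin_mixed_seminorms
  proof
    fix x assume "x \<in> U"
    with that obtain p r where "p \<in> P" "r > 0" "\<And>y. p (y - x) < r \<Longrightarrow> y \<in> U"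
      unfolding openin_tau by meson
    then show "\<exists>p\<in>mixed_seminorms. \<exists>r>0. \<forall>y. p (y - x) < r \<longrightarrow> y \<in> U"
      using P_subset_mixed by (intro bexI[of _ p] exI[of _ r]) auto
  qed
  show "openin euclidean U" if U: "openin ?T U" for U
  proof -
    have "\<exists>e>0. \<forall>y. dist y x < e \<longrightarrow> y \<in> U" if x: "x \<in> U" for x
    proof -
      obtain q r where q: "q \<in> mixed_seminorms" "r > 0" "\<And>y. q (y - x) < r \<Longrightarrow> y \<in> U"
        using openin_mixed_seminormsD[OF U x] by blast
      obtain C where C: "0 < C" "\<And>x. q x \<le> C * norm x" using mixed_le_norm[OF q(1)] by blast
      have "y \<in> U" if "dist y x < r / C" for y
      proof (rule q(3))
        have "C * norm (y - x) < r" using that C(1) by (simp add: dist_norm field_simps)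
        then show "q (y - x) < r" using C(2)[of "y - x"] by linarith
      qed
      moreover have "r / C > 0" using q(2) C(1) by simp
      ultimately show ?thesis by blast
    qed
    then show ?thesis by (simp add: open_dist)
  qed
  fix B :: "'a set" assume "bounded B"
  then obtain b where b: "\<And>x. x \<in> B \<Longrightarrow> norm x \<le> b" by (auto simp: bounded_iff)
  show "subtopology ?T B = subtopology \<tau> B"
  proof (rule coarser_antisym)
    show "coarser (subtopology \<tau> B) (subtopology ?T B)"
      using finer unfolding openin_subtopology by blast
    show "coarser (subtopology ?T B) (subtopology \<tau> B)"
    proof (intro allI impI)
      fix V assume "openin (subtopology ?T B) V"
      then obtain U where U: "openin ?T U" "V = U \<inter> B" by (auto simp: openin_subtopology)
      show "openin (subtopology \<tau> B) V"
      proof (subst openin_subopen, intro ballI)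
        fix x assume "x \<in> V"
        then have x: "x \<in> U" "x \<in> B" using U(2) by auto
        obtain q r where q: "q \<in> mixed_seminorms" "r > 0" "\<And>y. q (y - x) < r \<Longrightarrow> y \<in> U"
          using openin_mixed_seminormsD[OF U(1) x(1)] by blast
        \<comment> \<open>The radius is \<open>b + b\<close> because the estimate is applied to
          differences of two points of \<open>B\<close>.\<close>
        obtain p d where p: "p \<in> P" "0 < d" "\<And>z. norm z \<le> b + b \<Longrightarrow> p z < d \<Longrightarrow> q z < r"
          using mixed_small[OF q(1,2)] by blast
        have "openin \<tau> {y. p (y - x) < d}"
          unfolding generates by (rule openin_seminorm_ball[OF vs directed p(1)])
        then have "openin (subtopology \<tau> B) ({y. p (y - x) < d} \<inter> B)"
          by (auto simp: openin_subtopology)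
        moreover have "x \<in> {y. p (y - x) < d} \<inter> B" using x U p PD(1)[OF p(1)] by simp
        moreover have "{y. p (y - x) < d} \<inter> B \<subseteq> V"
        proof safe
          fix y assume y: "p (y - x) < d" "y \<in> B"
          have "norm (y - x) \<le> b + b"
            using norm_triangle_ineq4[of y x] b[of y] b[of x] x U y by auto
          then show "y \<in> V" using p(3) q(3) y U by blast
        qed
        ultimately show "\<exists>T. openin (subtopology \<tau> B) T \<and> x \<in> T \<and> T \<subseteq> V" by blast
      qed
    qed
  qed
qed

text \<open>Every neighbourhood \<open>W 0\<close> of \<open>0\<close> contains the sums \<open>\<Sum>k<n. W (Suc k)\<close> of smaller
  neighbourhoods, and \<open>W (Suc k)\<close> contains a set \<open>{p k < d k} \<inter> (k + 1) B\<close>. Hence \<open>W 0\<close> contains the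
  open unit ball of the infimal convolution of the seminorms \<open>p k / d k + norm / (k + 1)\<close>.\<close>

lemma mixed_candidate_nhd_zero:
  assumes \<sigma>: "mixed_candidate smul \<tau> \<sigma>" and W0: "openin \<sigma> W0" "0 \<in> W0"
  shows "\<exists>q\<in>mixed_seminorms. \<forall>x. q x < 1 \<longrightarrow> x \<in> W0"
proof -
  have top: "topspace \<sigma> = UNIV"
    and add: "continuous_map (prod_topology \<sigma> \<sigma>) \<sigma> (\<lambda>(x, y). x + y)"
    and sub: "\<And>B. bounded B \<Longrightarrow> subtopology \<sigma> B = subtopology \<tau> B"
    using \<sigma> by (auto simp: mixed_candidate_def linear_topology_def)
  have halve: "\<exists>V. (openin \<sigma> V \<and> 0 \<in> V) \<and> (\<forall>x\<in>V. \<forall>y\<in>V. x + y \<in> W)" if W: "openin \<sigma> W \<and> 0 \<in> W" for W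
  proof -
    have "openin (prod_topology \<sigma> \<sigma>) {z \<in> topspace (prod_topology \<sigma> \<sigma>). (case z of (x, y) \<Rightarrow> x + y) \<in> W}"
      using W by (intro openin_continuous_map_preimage[OF add]) auto
    moreover have "(0, 0) \<in> {z \<in> topspace (prod_topology \<sigma> \<sigma>). (case z of (x, y) \<Rightarrow> x + y) \<in> W}"
      using W top by simp
    ultimately obtain U V where UV: "openin \<sigma> U" "openin \<sigma> V" "0 \<in> U" "0 \<in> V"
      "U \<times> V \<subseteq> {z \<in> topspace (prod_topology \<sigma> \<sigma>). (case z of (x, y) \<Rightarrow> x + y) \<in> W}"
      unfolding openin_prod_topology_alt by meson
    have "x + y \<in> W" if "x \<in> U \<inter> V" "y \<in> U \<inter> V" for x y
    proof -
      have "(x, y) \<in> U \<times> V" using that by simp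
      from subsetD[OF UV(5) this] show ?thesis by simp
    qed
    then show ?thesis using UV by (intro exI[of _ "U \<inter> V"]) auto
  qed
  have "\<exists>W. \<forall>k. ((openin \<sigma> (W k) \<and> 0 \<in> W k) \<and> (k = 0 \<longrightarrow> W k = W0)) \<and>
      (\<forall>x\<in>W (Suc k). \<forall>y\<in>W (Suc k). x + y \<in> W k)"
    by (rule dependent_nat_choice) (use W0 halve in auto)
  then obtain W where W: "\<And>k. openin \<sigma> (W k) \<and> 0 \<in> W k" "W 0 = W0"
    and Wadd: "\<And>k x y. x \<in> W (Suc k) \<Longrightarrow> y \<in> W (Suc k) \<Longrightarrow> x + y \<in> W k" by blast
  \<comment> \<open>The shift \<open>m\<close> lets the induction split off the first summand: it
    lies in \<open>W (Suc m)\<close>, and so does the sum of the rest.\<close>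
  have Wsum: "(\<Sum>k<n. y k) \<in> W m" if "\<And>k. k < n \<Longrightarrow> y k \<in> W (Suc (m + k))" for n m and y :: "nat \<Rightarrow> 'a"
    using that
  proof (induction n arbitrary: m y)
    case 0
    then show ?case using W by simp
  next
    case (Suc n)
    have "(\<Sum>k<n. y (Suc k)) \<in> W (Suc m)" by (rule Suc.IH) (use Suc.prems in fastforce)
    moreover have "y 0 \<in> W (Suc m)" using Suc.prems[of 0] by simp
    ultimately show ?case unfolding sum.lessThan_Suc_shift using Wadd by blast
  qed
  have "\<exists>p d. p \<in> P \<and> 0 < d \<and> (\<forall>x. norm x < real (Suc k) \<longrightarrow> p x < d \<longrightarrow> x \<in> W (Suc k))" for k
  proof -
    have "openin (subtopology \<sigma> (ball 0 (Suc k))) (W (Suc k) \<inter> ball 0 (Suc k))"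
      using W(1) by (auto simp: openin_subtopology)
    then obtain U where U: "openin \<tau> U" "W (Suc k) \<inter> ball 0 (Suc k) = U \<inter> ball 0 (Suc k)"
      unfolding sub[OF bounded_ball] by (auto simp: openin_subtopology)
    moreover have "0 \<in> U"
    proof -
      have "0 \<in> W (Suc k) \<inter> ball 0 (Suc k)" using W(1)[of "Suc k"] by simp
      then show ?thesis unfolding U(2) by simp
    qed
    ultimately obtain p d where p: "p \<in> P" "0 < d" "\<And>x. p (x - 0) < d \<Longrightarrow> x \<in> U"
      unfolding openin_tau by blast
    have "x \<in> W (Suc k)" if "norm x < real (Suc k)" "p x < d" for x
    proof -
      have "x \<in> U \<inter> ball 0 (Suc k)" using that p(3) by simp
      then show ?thesis using U(2) by blast
    qed
    then show ?thesis using p(1,2) by blast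
  qed
  then obtain p d where p: "\<And>k. p k \<in> P" "\<And>k. 0 < d k"
    and pW: "\<And>k x. norm x < real (Suc k) \<Longrightarrow> p k x < d k \<Longrightarrow> x \<in> W (Suc k)" by metis
  \<comment> \<open>Because the balls grow with \<open>k\<close>, the norm gets a weight tending to
    0. Together with \<open>inf_convolution_le\<close> this puts the infimal convolution into
    \<open>mixed_seminorms\<close>.\<close>
  define r where "r k x = p k x / d k + norm x / real (Suc k)" for k x
  have r: "seminorm smul (r k)" for k
    unfolding seminorm_def
  proof (intro conjI allI)
    show "0 \<le> r k x" for x using PD(3)[OF p(1)] p(2)[of k] by (simp add: r_def)
    show "r k (x + y) \<le> r k x + r k y" for x y
    proof -
      have "p k (x + y) / d k \<le> (p k x + p k y) / d k"
        "norm (x + y) / real (Suc k) \<le> (norm x + norm y) / real (Suc k)"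
        using PD(4)[OF p(1)] p(2)[of k] by (auto intro!: divide_right_mono norm_triangle_ineq)
      then show ?thesis by (simp add: r_def add_divide_distrib)
    qed
    show "r k (smul c x) = norm c * r k x" for c x
      using PD(5)[OF p(1)] by (simp add: r_def norm_scale distrib_left)
  qed
  have rW: "x \<in> W (Suc k)" if "r k x < 1" for k x
  proof (rule pW)
    have "p k x / d k \<ge> 0" "norm x / real (Suc k) \<ge> 0" using PD(3)[OF p(1)] p(2)[of k] by auto
    then have "p k x / d k < 1" "norm x / real (Suc k) < 1" using that unfolding r_def by linarith+
    then show "norm x < real (Suc k)" "p k x < d k" using p(2)[of k] by auto
  qed
  define q where "q = inf_convolution r"
  have "seminorm smul q" unfolding q_def by (rule seminorm_inf_convolution[OF vs r])
  moreover have "\<exists>p\<in>P. \<exists>K\<ge>0. \<forall>x. q x \<le> K * p x + \<epsilon> * norm x" if \<epsilon>: "\<epsilon> > 0" for \<epsilon>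
  proof -
    obtain k where k: "1 / real (Suc k) < \<epsilon>" using \<epsilon> nat_approx_posE by blast
    have "q x \<le> 1 / d k * p k x + \<epsilon> * norm x" for x
    proof -
      have "q x \<le> r k x" unfolding q_def by (rule inf_convolution_le[OF vs r])
      also have "\<dots> \<le> 1 / d k * p k x + \<epsilon> * norm x"
        using mult_right_mono[OF less_imp_le[OF k] norm_ge_zero[of x]] by (simp add: r_def)
      finally show ?thesis .
    qed
    moreover have "0 \<le> 1 / d k" using p(2)[of k] by simp
    ultimately show ?thesis using p(1) by blast
  qed
  ultimately have "q \<in> mixed_seminorms" by (simp add: mixed_seminorms_def)
  moreover have "x \<in> W0" if x: "q x < 1" for x
  proof -
    obtain n y where y: "(\<Sum>k<n. y k) = x" "(\<Sum>k<n. r k (y k)) < 1"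
      using inf_convolution_less[OF vs r x[unfolded q_def]] by blast
    have "y k \<in> W (Suc k)" if "k < n" for k
    proof (rule rW)
      have "r k (y k) \<le> (\<Sum>k<n. r k (y k))"
        using that seminormD(3)[OF vs r] by (intro member_le_sum) auto
      then show "r k (y k) < 1" using y(2) by simp
    qed
    then show ?thesis using Wsum[of n y 0] y(1) W(2) by simp
  qed
  ultimately show ?thesis by blast
qed

text \<open>The neighbourhoods of 0 are settled by \<open>mixed_candidate_nhd_zero\<close>;
  continuity of translations in a linear topology carries the result to all points.\<close>

lemma mixed_topology_eq: "mixed_topology smul \<tau> = seminorm_topology mixed_seminorms"
proof (rule coarser_antisym)
  show "coarser (seminorm_topology mixed_seminorms) (mixed_topology smul \<tau>)"
    by (rule mixed_topology_finest[OF mixed_candidate_seminorms])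
  let ?\<gamma> = "mixed_topology smul \<tau>"
  note cand = mixed_candidate_mixed_topology
  have top: "topspace ?\<gamma> = UNIV"
    and add: "continuous_map (prod_topology ?\<gamma> ?\<gamma>) ?\<gamma> (\<lambda>(x, y). x + y)"
    using cand by (auto simp: mixed_candidate_def linear_topology_def)
  show "coarser ?\<gamma> (seminorm_topology mixed_seminorms)"
    unfolding openin_mixed_seminorms
  proof (intro allI impI ballI)
    fix U x assume U: "openin ?\<gamma> U" "x \<in> U"
    have "continuous_map ?\<gamma> (prod_topology ?\<gamma> ?\<gamma>) (\<lambda>y. (y, x))"
      by (intro continuous_map_pairedI) (auto simp: top)
    from continuous_map_compose[OF this add]
    have "continuous_map ?\<gamma> ?\<gamma> (\<lambda>y. y + x)" by (simp add: o_def)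
    then have "openin ?\<gamma> {y \<in> topspace ?\<gamma>. y + x \<in> U}" by (rule openin_continuous_map_preimage[OF _ U(1)])
    moreover have "0 \<in> {y \<in> topspace ?\<gamma>. y + x \<in> U}" using U(2) top by simp
    ultimately obtain q where q: "q \<in> mixed_seminorms" "\<And>y. q y < 1 \<Longrightarrow> y + x \<in> U"
      using mixed_candidate_nhd_zero[OF cand] by blast
    have "y \<in> U" if "q (y - x) < 1" for y using q(2)[OF that] by simp
    then show "\<exists>p\<in>mixed_seminorms. \<exists>r>0. \<forall>y. p (y - x) < r \<longrightarrow> y \<in> U"
      using q(1) zero_less_one by blast
  qed
qed

section \<open>Bounded sets and sequences in the mixed topology\<close>

lemma P_dominates_finite:
  fixes N :: nat
  assumes "\<And>n. p n \<in> P"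
  shows "\<exists>w\<in>P. \<exists>K\<ge>0. \<forall>n<N. \<forall>x. p n x \<le> K * w x"
proof (induction N)
  case 0
  then show ?case using P_nonempty by auto
next
  case (Suc N)
  then obtain w K where w: "w \<in> P" "K \<ge> 0" "\<And>n x. n < N \<Longrightarrow> p n x \<le> K * w x" by blast
  obtain v C where v: "v \<in> P" "C \<ge> 0" "\<And>x. max (w x) (p N x) \<le> C * v x"
    using directed w(1) assms unfolding directed_seminorms_def by blast
  have "p n x \<le> (K * C + C) * v x" if "n < Suc N" for n x
  proof (cases "n = N")
    case True
    have "0 \<le> K * C * v x" using w(2) v(2) PD(3)[OF v(1)] by simp
    then show ?thesis using v(3)[of x] by (simp add: True distrib_right)
  next
    case False
    then have "p n x \<le> K * w x" using w(3) that by simp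
    also have "\<dots> \<le> K * (C * v x)" using v(3)[of x] w(2) by (intro mult_left_mono) auto
    finally show ?thesis using v(2) PD(3)[OF v(1), of x] by (simp add: distrib_right add_increasing2)
  qed
  then show ?case using v(1,2) w(2) by (metis add_nonneg_nonneg mult_nonneg_nonneg)
qed

text \<open>Beyond some \<open>N\<close> the weights are below \<open>\<epsilon>\<close>, and the
  norm absorbs those terms; by directedness one member of \<open>P\<close> dominates the finitely
  many others.\<close>

lemma submixed_seminorm:
  assumes p: "\<And>n. p n \<in> P" and a: "\<And>n. 0 \<le> a n" "a \<longlonglongrightarrow> 0"
  shows "(\<lambda>x. SUP n. p n x * a n) \<in> mixed_seminorms" and "p n x * a n \<le> (SUP n. p n x * a n)"
proof -
  obtain A where A: "\<And>n. a n \<le> A"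
    using convergent_imp_Bseq[of a] a(2) by (auto simp: convergent_def Bseq_def) (metis abs_le_D1)
  have bdd: "bdd_above (range (\<lambda>n. p n x * a n))" for x
  proof (rule bdd_aboveI2)
    show "p n x * a n \<le> norm x * A" for n
      using P_le_norm[OF p] a(1) A PD(3)[OF p] by (intro mult_mono) auto
  qed
  show upper: "p n x * a n \<le> (SUP n. p n x * a n)" for n x
    by (rule cSUP_upper[OF _ bdd]) simp
  have "seminorm smul (\<lambda>x. SUP n. p n x * a n)"
  proof (rule seminorm_SUP[OF vs _ _ bdd])
    show "seminorm smul (\<lambda>x. p n x * a n)" for n
      using PD(3,4,5)[OF p] a(1)
      by (auto simp: seminorm_def simp flip: distrib_right intro: mult_right_mono)
  qed simp
  moreover have "\<exists>w\<in>P. \<exists>K\<ge>0. \<forall>x. (SUP n. p n x * a n) \<le> K * w x + \<epsilon> * norm x" if \<epsilon>: "\<epsilon> > 0" for \<epsilon>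
  proof -
    obtain N where N: "\<And>n. N \<le> n \<Longrightarrow> a n < \<epsilon>"
      using order_tendstoD(2)[OF a(2) \<epsilon>] by (auto simp: eventually_sequentially)
    obtain w K where w: "w \<in> P" "K \<ge> 0" "\<And>n x. n < N \<Longrightarrow> p n x \<le> K * w x"
      using P_dominates_finite[of p N, OF p] by blast
    have A0: "0 \<le> A" using a(1)[of 0] A[of 0] by simp
    have "(SUP n. p n x * a n) \<le> (K * A) * w x + \<epsilon> * norm x" for x
    proof (rule cSUP_least)
      fix n
      show "p n x * a n \<le> (K * A) * w x + \<epsilon> * norm x"
      proof (cases "n < N")
        case True
        have "p n x * a n \<le> (K * w x) * A"
          using w(3)[OF True] A[of n] a(1) w(2) PD(3)[OF w(1)] by (intro mult_mono) auto
        then show ?thesis using \<epsilon> by (simp add: mult.commute mult.left_commute add_increasing2)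
      next
        case False
        then have "p n x * a n \<le> norm x * \<epsilon>"
          using N[of n] P_le_norm[OF p] a(1) by (intro mult_mono) auto
        then show ?thesis using w(2) A0 PD(3)[OF w(1), of x] by (simp add: mult.commute add_increasing)
      qed
    qed simp
    then show ?thesis using w(1,2) A0 by (metis mult_nonneg_nonneg)
  qed
  ultimately show "(\<lambda>x. SUP n. p n x * a n) \<in> mixed_seminorms" by (simp add: mixed_seminorms_def)
qed

text \<open>If \<open>D\<close> contains \<open>x n\<close> with \<open>p n (x n) > (n + 1)\<^sup>2\<close>, then the submixed seminorm
  \<open>SUP n. p n x / (n + 1)\<close> is unbounded on \<open>D\<close>.\<close>

lemma bounded_if_mixed_seminorms_bounded:
  assumes "\<And>q. q \<in> mixed_seminorms \<Longrightarrow> \<exists>b. \<forall>x\<in>D. q x \<le> b"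
  shows "bounded D"
proof (rule ccontr)
  assume "\<not> bounded D"
  then have "\<exists>x\<in>D. (real (Suc n))\<^sup>2 < norm x" for n by (auto simp: bounded_iff not_le)
  then have "\<exists>x p. x \<in> D \<and> p \<in> P \<and> (real (Suc n))\<^sup>2 < p x" for n using less_norm_P by meson
  then obtain x p where x: "\<And>n. x n \<in> D" and p: "\<And>n. p n \<in> P" and
    big: "\<And>n. (real (Suc n))\<^sup>2 < p n (x n)" by metis
  define a where "a n = 1 / real (Suc n)" for n
  have a: "\<And>n. 0 \<le> a n" "a \<longlonglongrightarrow> 0" using LIMSEQ_Suc[OF lim_1_over_n] by (auto simp: a_def[abs_def])
  obtain b where b: "\<And>z. z \<in> D \<Longrightarrow> (SUP n. p n z * a n) \<le> b"
    using assms[OF submixed_seminorm(1)[of p a, OF p a]] by blast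
  obtain n where n: "b < real n" using reals_Archimedean2 by blast
  have "real (Suc n) = (real (Suc n))\<^sup>2 * a n" by (simp add: a_def power2_eq_square)
  also have "\<dots> \<le> p n (x n) * a n" using big[of n] a(1) by (intro mult_right_mono) auto
  also have "\<dots> \<le> b" 
    using submixed_seminorm(2)[of p a n "x n", OF p a] b[OF x[of n]] by simp
  finally show False using n by simp
qed

lemma hausdorff_lcs_mixed: "hausdorff_lcs smul (mixed_topology smul \<tau>)"
proof -
  have "\<forall>x. x \<noteq> 0 \<longrightarrow> (\<exists>p\<in>mixed_seminorms. p x \<noteq> 0)"
    using Hausdorff P_subset_mixed unfolding generates Hausdorff_space_seminorm_topology[OF vs directed]
    by blast
  then have "Hausdorff_space (seminorm_topology mixed_seminorms)"
    by (simp only: Hausdorff_space_seminorm_topology[OF vs mixed_seminorms_directed])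
  with vs mixed_seminorms_directed show ?thesis
    unfolding hausdorff_lcs_def mixed_topology_eq by (intro conjI exI) (assumption | rule refl)+
qed

lemma limitin_tau: "limitin \<tau> u x F \<longleftrightarrow> (\<forall>p\<in>P. \<forall>r>0. \<forall>\<^sub>F n in F. p (u n - x) < r)"
  unfolding generates by (rule limitin_seminorm_topology[OF vs directed])

lemma limitin_mixed:
  "limitin (mixed_topology smul \<tau>) u x F \<longleftrightarrow>
    (\<forall>q\<in>mixed_seminorms. \<forall>r>0. \<forall>\<^sub>F n in F. q (u n - x) < r)"
  unfolding mixed_topology_eq by (rule limitin_seminorm_topology[OF vs mixed_seminorms_directed])

lemma limitin_mixed_sequentially:
  "limitin (mixed_topology smul \<tau>) u x sequentially \<longleftrightarrow>
    bounded (range u) \<and> limitin \<tau> u x sequentially"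
proof
  assume L: "limitin (mixed_topology smul \<tau>) u x sequentially"
  have "bounded (range u)"
  proof (rule bounded_if_mixed_seminorms_bounded)
    fix q assume q: "q \<in> mixed_seminorms"
    then have "\<forall>\<^sub>F n in sequentially. q (u n - x) < 1" using L by (simp add: limitin_mixed)
    then obtain N where N: "\<And>n. N \<le> n \<Longrightarrow> q (u n - x) < 1" by (auto simp: eventually_sequentially)
    \<comment> \<open>The sum covers the finitely many early terms; the later ones are within 1 of
      \<open>x\<close>.\<close>
    have "q (u n) \<le> (\<Sum>k<N. q (u k)) + (1 + q x)" for n
    proof (cases "n < N")
      case True
      then have "q (u n) \<le> (\<Sum>k<N. q (u k))" using mixedD(3)[OF q] by (intro member_le_sum) auto
      then show ?thesis using mixedD(3)[OF q, of x] by simp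
    next
      case False
      have "0 \<le> (\<Sum>k<N. q (u k))" using mixedD(3)[OF q] by (simp add: sum_nonneg)
      then show ?thesis using mixedD(4)[OF q, of "u n - x" x] N[of n] False by simp
    qed
    then show "\<exists>b. \<forall>x\<in>range u. q x \<le> b" by blast
  qed
  then show "bounded (range u) \<and> limitin \<tau> u x sequentially"
    using L P_subset_mixed unfolding limitin_mixed limitin_tau by blast
next
  assume R: "bounded (range u) \<and> limitin \<tau> u x sequentially"
  then obtain b where b: "\<And>n. norm (u n) \<le> b" by (auto simp: bounded_iff)
  have b': "norm (u n - x) \<le> b + norm x" for n using norm_triangle_ineq4[of "u n" x] b[of n] by simp
  show "limitin (mixed_topology smul \<tau>) u x sequentially"
    unfolding limitin_mixed
  proof (intro ballI allI impI)
    fix q and r :: real assume "q \<in> mixed_seminorms" "0 < r"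
    then obtain p d where p: "p \<in> P" "0 < d" "\<And>z. norm z \<le> b + norm x \<Longrightarrow> p z < d \<Longrightarrow> q z < r"
      using mixed_small by blast
    have "\<forall>\<^sub>F n in sequentially. p (u n - x) < d" using R p(1,2) by (auto simp: limitin_tau)
    then show "\<forall>\<^sub>F n in sequentially. q (u n - x) < r"
      by (rule eventually_mono) (use b' p(3) in blast)
  qed
qed

text \<open>Continuous seminorms are bounded on compact sets. Applied to orbits over a compact index
  set, this supplies the pointwise bounds for the uniform boundedness principle.\<close>

lemma compactin_mixed_bounded:
  assumes D: "compactin (mixed_topology smul \<tau>) D"
  shows "bounded D"
proof (rule bounded_if_mixed_seminorms_bounded)
  fix q assume "q \<in> mixed_seminorms"
  then have "continuous_map (mixed_topology smul \<tau>) euclideanreal q"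
    using continuous_seminormI[OF vs mixed_seminorms_directed]
    by (simp add: mixed_topology_eq continuous_seminorms_def)
  then have "compact (q ` D)" using image_compactin[OF D] by fastforce
  then show "\<exists>b. \<forall>x\<in>D. q x \<le> b"
    using compact_imp_bounded bounded_imp_bdd_above by (metis bdd_above.unfold imageI)
qed

section \<open>Families of linear maps\<close>

lemma equicontinuous_mixed:
  "equicontinuous_family smul (mixed_topology smul \<tau>) J S \<longleftrightarrow>
    (\<forall>q\<in>mixed_seminorms. \<exists>w\<in>mixed_seminorms. \<exists>K\<ge>0. \<forall>t\<in>J. \<forall>x. q (S t x) \<le> K * w x)"
  unfolding mixed_topology_eq equicontinuous_family_generating[OF vs mixed_seminorms_directed]
  by (simp add: equicontinuous_wrt_def)

text \<open>The members of \<open>P\<close> are mixed seminorms, and expanding the mixed seminorm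
  that dominates them produces the norm term. Its coefficient is divided by \<open>K + 1\<close> to
  survive the factor \<open>K\<close>.\<close>

lemma equicontinuous_imp_equitight:
  assumes "equicontinuous_family smul (mixed_topology smul \<tau>) J S"
  shows "equitight P J S"
  unfolding equitight_def
proof (intro allI impI ballI)
  fix \<epsilon> :: real and p assume \<epsilon>: "0 < \<epsilon>" and "p \<in> P"
  then obtain w K where w: "w \<in> mixed_seminorms" "K \<ge> 0" "\<And>t x. t \<in> J \<Longrightarrow> p (S t x) \<le> K * w x"
    using assms P_subset_mixed unfolding equicontinuous_mixed by blast
  have "0 < \<epsilon> / (K + 1)" using \<epsilon> w(2) by simp
  then obtain q C where q: "q \<in> P" "0 \<le> C" "\<And>x. w x \<le> C * q x + \<epsilon> / (K + 1) * norm x"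
    using mixed_seminorms_bound[OF w(1)] by blast
  have "p (S t x) \<le> (K * C) * q x + \<epsilon> * norm x" if "t \<in> J" for t x
  proof -
    have "K * w x \<le> K * (C * q x + \<epsilon> / (K + 1) * norm x)" by (rule mult_left_mono[OF q(3) w(2)])
    moreover have "K * (\<epsilon> / (K + 1) * norm x) \<le> \<epsilon> * norm x"
    proof -
      have "K * (\<epsilon> / (K + 1)) \<le> \<epsilon>" using \<epsilon> w(2) by (simp add: field_simps)
      then show ?thesis by (metis mult.assoc mult_right_mono norm_ge_zero)
    qed
    ultimately show ?thesis using w(3)[OF that, of x] by (simp add: distrib_left)
  qed
  then show "\<exists>q\<in>P. \<exists>K\<ge>0. \<forall>t\<in>J. \<forall>x. p (S t x) \<le> K * q x + \<epsilon> * norm x"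
    using q(1,2) w(2) by (metis mult_nonneg_nonneg)
qed

lemma equitight_imp_equicontinuous:
  assumes lin: "\<And>t. t \<in> J \<Longrightarrow> Vector_Spaces.linear smul smul (S t)"
    and C: "0 \<le> C" "\<And>t x. t \<in> J \<Longrightarrow> norm (S t x) \<le> C * norm x"
    and tight: "equitight P J S"
  shows "equicontinuous_family smul (mixed_topology smul \<tau>) J S"
  unfolding equicontinuous_mixed
proof
  fix q assume q: "q \<in> mixed_seminorms"
  show "\<exists>w\<in>mixed_seminorms. \<exists>K\<ge>0. \<forall>t\<in>J. \<forall>x. q (S t x) \<le> K * w x"
  \<comment> \<open>For empty \<open>J\<close> the supremum used below would be an unspecified
    value.\<close>
  proof (cases "J = {}")
    case True
    then show ?thesis using q by auto
  next
    case False
    have bound: "\<exists>p\<in>P. \<exists>K\<ge>0. \<forall>t\<in>J. \<forall>x. q (S t x) \<le> K * p x + \<epsilon> * norm x" if \<epsilon>: "0 < \<epsilon>" for \<epsilon>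
    proof -
      \<comment> \<open>Two norm terms share \<open>\<epsilon>\<close>: that of \<open>q\<close> is
        multiplied by the operator bound \<open>C\<close>, and that of equitightness, with
        \<open>\<eta>\<close>, by \<open>K\<close>.\<close>
      define \<delta> where "\<delta> = \<epsilon> / 2 / (C + 1)"
      have \<delta>: "0 < \<delta>" "\<delta> * C \<le> \<epsilon> / 2" using \<epsilon> C(1) by (auto simp: \<delta>_def field_simps)
      obtain p K where p: "p \<in> P" "0 \<le> K" "\<And>x. q x \<le> K * p x + \<delta> * norm x"
        using mixed_seminorms_bound[OF q \<delta>(1)] by blast
      define \<eta> where "\<eta> = \<epsilon> / 2 / (K + 1)"
      have \<eta>: "0 < \<eta>" "K * \<eta> \<le> \<epsilon> / 2" using \<epsilon> p(2) by (auto simp: \<eta>_def field_simps)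
      obtain w L where w: "w \<in> P" "0 \<le> L" "\<And>t x. t \<in> J \<Longrightarrow> p (S t x) \<le> L * w x + \<eta> * norm x"
        using tight[unfolded equitight_def, rule_format, OF \<eta>(1) p(1)] by blast
      have "q (S t x) \<le> (K * L) * w x + \<epsilon> * norm x" if t: "t \<in> J" for t x
      proof -
        have "q (S t x) \<le> K * p (S t x) + \<delta> * norm (S t x)" by (rule p(3))
        also have "\<dots> \<le> K * (L * w x + \<eta> * norm x) + \<delta> * (C * norm x)"
          using w(3)[OF t] C(2)[OF t] p(2) \<delta>(1) by (intro add_mono mult_left_mono) auto
        also have "\<dots> = (K * L) * w x + (K * \<eta> + \<delta> * C) * norm x" by (simp add: algebra_simps)
        also have "\<dots> \<le> (K * L) * w x + \<epsilon> * norm x"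
          using \<delta>(2) \<eta>(2) by (intro add_left_mono mult_right_mono) auto
        finally show ?thesis .
      qed
      then show ?thesis using w(1,2) p(2) by (metis mult_nonneg_nonneg)
    qed
    define w where "w x = (SUP t\<in>J. q (S t x))" for x
    have bdd: "bdd_above ((\<lambda>t. q (S t x)) ` J)" for x
      using bound[OF zero_less_one] by (auto simp: bdd_above_def)
    have "seminorm smul w"
      unfolding w_def
      by (rule seminorm_SUP[OF vs False seminorm_comp_linear[OF mixed_seminorm[OF q] lin] bdd])
    moreover have "\<exists>p\<in>P. \<exists>K\<ge>0. \<forall>x. w x \<le> K * p x + \<epsilon> * norm x" if "0 < \<epsilon>" for \<epsilon>
    proof -
      obtain p K where "p \<in> P" "0 \<le> K" "\<And>t x. t \<in> J \<Longrightarrow> q (S t x) \<le> K * p x + \<epsilon> * norm x"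
        using bound[OF \<open>0 < \<epsilon>\<close>] by blast
      then show ?thesis unfolding w_def by (intro bexI[of _ p] exI[of _ K]) (auto intro: cSUP_least[OF False])
    qed
    ultimately have "w \<in> mixed_seminorms" by (simp add: mixed_seminorms_def)
    moreover have "q (S t x) \<le> 1 * w x" if "t \<in> J" for t x
      unfolding w_def using cSUP_upper[OF that bdd] by simp
    ultimately show ?thesis by (blast intro: zero_le_one)
  qed
qed

lemma seminorm_scaleR: "seminorm smul q \<Longrightarrow> q (r *\<^sub>R x) = \<bar>r\<bar> * q x"
  using seminormD(5)[OF vs, of q "of_real r" x] by (simp add: scale_of_real)

lemma linear_scaleR: "Vector_Spaces.linear smul smul T \<Longrightarrow> T (r *\<^sub>R x) = r *\<^sub>R T x"
  by (simp add: Vector_Spaces.linear_iff flip: scale_of_real)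

text \<open>All mixed seminorms are bounded on the union \<open>D\<close> of the images of the unit
  ball, which makes \<open>D\<close> norm bounded; scaling turns this into an operator
  bound.\<close>

lemma equicontinuous_imp_bounded:
  assumes lin: "\<And>t. t \<in> J \<Longrightarrow> Vector_Spaces.linear smul smul (S t)"
    and eq: "equicontinuous_family smul (mixed_topology smul \<tau>) J S"
  shows "\<And>t. t \<in> J \<Longrightarrow> bounded_linear (S t)" and "bounded_family J S"
proof -
  define D where "D = {S t x |t x. t \<in> J \<and> norm x \<le> 1}"
  have "bounded D"
  proof (rule bounded_if_mixed_seminorms_bounded)
    fix q assume "q \<in> mixed_seminorms"
    then obtain w K where w: "w \<in> mixed_seminorms" "K \<ge> 0" "\<And>t x. t \<in> J \<Longrightarrow> q (S t x) \<le> K * w x"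
      using eq unfolding equicontinuous_mixed by blast
    obtain C where C: "0 < C" "\<And>x. w x \<le> C * norm x" using mixed_le_norm[OF w(1)] by blast
    have "q (S t x) \<le> K * C" if "t \<in> J" "norm x \<le> 1" for t x
    proof -
      have "C * norm x \<le> C" using C(1) that(2) by simp
      then have "K * w x \<le> K * C" using C(2)[of x] w(2) by (intro mult_left_mono) auto
      then show ?thesis using w(3)[OF that(1), of x] by simp
    qed
    then show "\<exists>b. \<forall>x\<in>D. q x \<le> b" unfolding D_def by blast
  qed
  then obtain C where C: "0 < C" "\<And>t x. t \<in> J \<Longrightarrow> norm x \<le> 1 \<Longrightarrow> norm (S t x) \<le> C"
    unfolding D_def bounded_pos by blast
  have bound: "norm (S t x) \<le> C * norm x" if t: "t \<in> J" for t x
  proof (cases "x = 0")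
    case True
    then show ?thesis using linear_scaleR[OF lin[OF t], of 0 0] by simp
  next
    case False
    have "norm (S t ((1 / norm x) *\<^sub>R x)) \<le> C" using False by (intro C(2)[OF t]) simp
    then show ?thesis using False by (simp add: linear_scaleR[OF lin[OF t]] field_simps)
  qed
  show bl: "bounded_linear (S t)" if t: "t \<in> J" for t
    using bound[OF t] linear_scaleR[OF lin[OF t]] lin[OF t]
    by (intro bounded_linear_intro[of _ C]) (auto simp: Vector_Spaces.linear_iff mult.commute)
  show "bounded_family J S"
  proof (subst bounded_family_bound)
    show "\<exists>C\<ge>0. \<forall>t\<in>J. \<forall>x. norm (S t x) \<le> C * norm x"
      using bound C(1) by (intro exI[of _ C]) simp
  qed (rule bl)
qed

section \<open>Bi-equicontinuity and C-sequential spaces\<close>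

lemma equicontinuous_imp_bi_equicontinuous:
  assumes eq: "equicontinuous_family smul (mixed_topology smul \<tau>) J S"
  shows "bi_equicontinuous \<tau> J S"
  unfolding bi_equicontinuous_def
proof (intro allI impI)
  fix u x U
  assume u: "bounded (range u) \<and> limitin \<tau> u x sequentially" and U: "openin \<tau> U \<and> 0 \<in> U"
  then obtain p r where p: "p \<in> P" "r > 0" "\<And>y. p (y - 0) < r \<Longrightarrow> y \<in> U" unfolding openin_tau by meson
  obtain w K where w: "w \<in> mixed_seminorms" "K \<ge> 0" "\<And>t x. t \<in> J \<Longrightarrow> p (S t x) \<le> K * w x"
    using eq p(1) P_subset_mixed unfolding equicontinuous_mixed by blast
  have "0 < r / (K + 1)" using p(2) w(2) by simp
  then have "\<forall>\<^sub>F n in sequentially. w (u n - x) < r / (K + 1)"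
    using u w(1) unfolding limitin_mixed_sequentially[symmetric] limitin_mixed by blast
  then show "\<forall>\<^sub>F n in sequentially. \<forall>t\<in>J. S t (u n - x) \<in> U"
  proof (rule eventually_mono, intro ballI)
    fix n t assume n: "w (u n - x) < r / (K + 1)" and t: "t \<in> J"
    have "K * w (u n - x) \<le> (K + 1) * w (u n - x)"
      using mixedD(3)[OF w(1)] by (intro mult_right_mono) auto
    also have "\<dots> < r" using n w(2) by (simp add: field_simps)
    finally show "S t (u n - x) \<in> U" using w(3)[OF t, of "u n - x"] by (intro p(3)) simp
  qed
qed

text \<open>The uniform norm bound keeps all \<open>S t (u n - x)\<close> in one ball, and there
  smallness for \<open>\<tau>\<close> implies smallness for \<open>q\<close>.\<close>

lemma bi_equicontinuous_mixed:
  assumes C: "\<And>t x. t \<in> J \<Longrightarrow> norm (S t x) \<le> C * norm x" and bi: "bi_equicontinuous \<tau> J S"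
    and u: "limitin (mixed_topology smul \<tau>) u x sequentially" and q: "q \<in> mixed_seminorms" "0 < e"
  shows "\<forall>\<^sub>F n in sequentially. \<forall>t\<in>J. q (S t (u n - x)) < e"
proof -
  have u': "bounded (range u)" "limitin \<tau> u x sequentially"
    using u by (auto simp: limitin_mixed_sequentially)
  then obtain b where b: "\<And>n. norm (u n) \<le> b" by (auto simp: bounded_iff)
  have b': "norm (S t (u n - x)) \<le> \<bar>C\<bar> * (b + norm x)" if "t \<in> J" for t n
  proof -
    have "norm (u n - x) \<le> b + norm x" using norm_triangle_ineq4[of "u n" x] b[of n] by simp
    then have "C * norm (u n - x) \<le> \<bar>C\<bar> * (b + norm x)" by (intro mult_mono) auto
    then show ?thesis using C[OF that, of "u n - x"] by simp
  qed
  obtain p d where p: "p \<in> P" "0 < d" "\<And>z. norm z \<le> \<bar>C\<bar> * (b + norm x) \<Longrightarrow> p z < d \<Longrightarrow> q z < e"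
    using mixed_small[OF q] by blast
  have "openin \<tau> {y. p (y - 0) < d}"
    unfolding generates by (rule openin_seminorm_ball[OF vs directed p(1)])
  moreover have "0 \<in> {y. p (y - 0) < d}" using p(2) PD(1)[OF p(1)] by simp
  ultimately have "\<forall>\<^sub>F n in sequentially. \<forall>t\<in>J. S t (u n - x) \<in> {y. p (y - 0) < d}"
    using bi u' unfolding bi_equicontinuous_def by blast
  then show ?thesis by (rule eventually_mono) (use b' p(3) in auto)
qed

lemma C_sequential_equicontinuous:
  assumes Cseq: "C_sequential (mixed_topology smul \<tau>)"
    and lin: "\<And>t. t \<in> J \<Longrightarrow> Vector_Spaces.linear smul smul (S t)"
    and C: "\<And>t x. t \<in> J \<Longrightarrow> norm (S t x) \<le> C * norm x" and bi: "bi_equicontinuous \<tau> J S"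
  shows "equicontinuous_family smul (mixed_topology smul \<tau>) J S"
  unfolding equicontinuous_mixed
proof
  fix q assume q: "q \<in> mixed_seminorms"
  note qD = mixedD[OF q]
  have qS: "seminorm smul (\<lambda>x. q (S t x))" if "t \<in> J" for t
    by (rule seminorm_comp_linear[OF mixed_seminorm[OF q] lin[OF that]])
  \<comment> \<open>A uniform bound \<open>r < 1\<close> replaces a formal supremum. A convergent
    sequence may use up half of the gap \<open>1 - r\<close>, which leaves the bound
    \<open>(1 + r) / 2\<close>.\<close>
  define U where "U = {x. \<exists>r<1. \<forall>t\<in>J. q (S t x) \<le> r}"
  have "convex U"
  proof (rule convexI)
    fix x y and u v :: real assume xy: "x \<in> U" "y \<in> U" and uv: "0 \<le> u" "0 \<le> v" "u + v = 1"
    from xy obtain r s where r: "r < 1" "\<And>t. t \<in> J \<Longrightarrow> q (S t x) \<le> r"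
      and s: "s < 1" "\<And>t. t \<in> J \<Longrightarrow> q (S t y) \<le> s" by (auto simp: U_def)
    have "q (S t (u *\<^sub>R x + v *\<^sub>R y)) \<le> max r s" if t: "t \<in> J" for t
    proof -
      have "q (S t (u *\<^sub>R x + v *\<^sub>R y)) \<le> u * q (S t x) + v * q (S t y)"
        using seminormD(4)[OF vs qS[OF t], of "u *\<^sub>R x" "v *\<^sub>R y"] uv(1,2)
        by (simp add: seminorm_scaleR[OF qS[OF t]])
      also have "\<dots> \<le> max r s"
        using r(2)[OF t] s(2)[OF t] uv by (intro convex_bound_le) auto
      finally show ?thesis .
    qed
    then show "u *\<^sub>R x + v *\<^sub>R y \<in> U" using r(1) s(1) by (auto simp: U_def intro!: exI[of _ "max r s"])
  qed
  moreover have "\<forall>\<^sub>F n in sequentially. u n \<in> U"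
    if x: "x \<in> U" and u: "limitin (mixed_topology smul \<tau>) u x sequentially" for u x
  proof -
    obtain r where r: "r < 1" "\<And>t. t \<in> J \<Longrightarrow> q (S t x) \<le> r" using x by (auto simp: U_def)
    have "\<forall>\<^sub>F n in sequentially. \<forall>t\<in>J. q (S t (u n - x)) < (1 - r) / 2"
      by (rule bi_equicontinuous_mixed[OF C bi u q]) (use r(1) in auto)
    then show ?thesis
    proof (rule eventually_mono)
      fix n assume n: "\<forall>t\<in>J. q (S t (u n - x)) < (1 - r) / 2"
      have "q (S t (u n)) \<le> (1 + r) / 2" if t: "t \<in> J" for t
        using seminormD(4)[OF vs qS[OF t], of "u n - x" x] n r(2)[OF t] t by (force simp: field_simps)
      then show "u n \<in> U" using r(1) by (auto simp: U_def intro!: exI[of _ "(1 + r) / 2"])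
    qed
  qed
  ultimately have "openin (mixed_topology smul \<tau>) U" using Cseq unfolding C_sequential_def by blast
  moreover have "0 \<in> U" using seminormD(1)[OF vs qS] by (auto simp: U_def intro!: exI[of _ 0])
  ultimately obtain w d where w: "w \<in> mixed_seminorms" "0 < d" "\<And>y. w (y - 0) < d \<Longrightarrow> y \<in> U"
    unfolding mixed_topology_eq using openin_mixed_seminormsD by blast
  have "q (S t x) \<le> 2 / d * w x" if t: "t \<in> J" for t x
  proof (rule seminorm_le_of_unit_ball[OF vs mixed_seminorm[OF w(1)] w(2)])
    show "q (S t (smul c x)) = norm c * q (S t x)" for c x by (rule seminormD(5)[OF vs qS[OF t]])
    show "q (S t x) \<le> 1" if "w x < d" for x using w(3)[of x] that t by (force simp: U_def)
  qed
  then show "\<exists>w\<in>mixed_seminorms. \<exists>K\<ge>0. \<forall>t\<in>J. \<forall>x. q (S t x) \<le> K * w x"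
    using w(1,2) by (intro bexI[of _ w] exI[of _ "2 / d"]) auto
qed

section \<open>Strong continuity and the action on the dual\<close>

lemma strongly_continuous_tau:
  assumes "strongly_continuous I (mixed_topology smul \<tau>) S"
  shows "strongly_continuous I \<tau> S"
proof -
  have cand: "mixed_candidate smul \<tau> (mixed_topology smul \<tau>)" by (rule mixed_candidate_mixed_topology)
  have "continuous_map I \<tau> f" if f: "continuous_map I (mixed_topology smul \<tau>) f" for f
    using f cand unfolding continuous_map_def topspace_tau mixed_candidate_def by auto
  then show ?thesis using assms by (auto simp: strongly_continuous_def)
qed

text \<open>Over a compact index set an orbit is norm bounded, and on bounded sets the two
  topologies agree. The \<open>k_lcs_space\<close> property then passes from compact sets to
  \<open>I\<close>.\<close>

lemma strongly_continuous_mixed: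
  assumes k: "k_lcs_space I" and strong: "strongly_continuous I \<tau> S"
    and bl: "\<And>t. t \<in> topspace I \<Longrightarrow> bounded_linear (S t)"
    and bounded: "on_compacts I (\<lambda>M. bounded_family M S)"
  shows "strongly_continuous I (mixed_topology smul \<tau>) S"
  unfolding strongly_continuous_def
proof
  fix x
  show "continuous_map I (mixed_topology smul \<tau>) (\<lambda>t. S t x)"
  proof (rule k_lcs_spaceD[OF k hausdorff_lcs_mixed])
    fix M assume M: "compactin I M"
    have MI: "M \<subseteq> topspace I" by (rule compactin_subset_topspace[OF M])
    obtain C where C: "\<And>t. t \<in> M \<Longrightarrow> norm (S t x) \<le> C * norm x"
      using bounded M bl MI bounded_family_bound[of M S] unfolding on_compacts_def by (metis subsetD)
    define B where "B = (\<lambda>t. S t x) ` M"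
    have "bounded B" using C by (auto simp: B_def bounded_iff)
    then have eq: "subtopology (mixed_topology smul \<tau>) B = subtopology \<tau> B"
      using mixed_candidate_mixed_topology unfolding mixed_candidate_def by blast
    have "continuous_map (subtopology I M) \<tau> (\<lambda>t. S t x)"
      using strong by (auto simp: strongly_continuous_def intro: continuous_map_from_subtopology)
    then have "continuous_map (subtopology I M) (subtopology \<tau> B) (\<lambda>t. S t x)"
      by (intro continuous_map_into_subtopology) (auto simp: B_def)
    then show "continuous_map (subtopology I M) (mixed_topology smul \<tau>) (\<lambda>t. S t x)"
      unfolding eq[symmetric] by (simp add: continuous_map_in_subtopology)
  qed
qed

lemma strongly_continuous_bounded_on_compacts:
  fixes S :: "'i \<Rightarrow> 'a \<Rightarrow> 'a"
  assumes complete: "complete (UNIV :: 'a set)"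
    and strong: "strongly_continuous I (mixed_topology smul \<tau>) S"
    and bl: "\<And>t. t \<in> topspace I \<Longrightarrow> bounded_linear (S t)" and M: "compactin I M"
  shows "\<exists>C\<ge>0. \<forall>t\<in>M. \<forall>x. norm (S t x) \<le> C * norm x"
proof (rule uniform_boundedness[OF complete])
  show "bounded_linear (S t)" if "t \<in> M" for t using bl compactin_subset_topspace[OF M] that by (blast dest: subsetD)
  show "bounded ((\<lambda>t. S t x) ` M)" for x
    by (rule compactin_mixed_bounded, rule image_compactin[OF M])
      (use strong in \<open>simp add: strongly_continuous_def\<close>)
qed

lemma equicontinuous_imp_continuous_map:
  assumes eq: "equicontinuous_family smul (mixed_topology smul \<tau>) J S"
    and t: "t \<in> J" and lin: "Vector_Spaces.linear smul smul (S t)"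
  shows "continuous_map (mixed_topology smul \<tau>) (mixed_topology smul \<tau>) (S t)"
  unfolding mixed_topology_eq continuous_map_seminorm_topology[OF vs mixed_seminorms_directed]
proof (intro ballI allI impI)
  fix x q and r :: real assume "q \<in> mixed_seminorms" and r: "0 < r"
  then obtain w K where w: "w \<in> mixed_seminorms" "K \<ge> 0" "\<And>x. q (S t x) \<le> K * w x"
    using eq t unfolding equicontinuous_mixed by blast
  interpret T: Vector_Spaces.linear smul smul "S t" by (rule lin)
  have "q (S t y - S t x) < r" if "w (y - x) < r / (K + 1)" for y
  proof -
    have "K * w (y - x) \<le> (K + 1) * w (y - x)" using mixedD(3)[OF w(1)] by (intro mult_right_mono) auto
    also have "\<dots> < r" using that w(2) by (simp add: field_simps)
    finally show ?thesis using w(3)[of "y - x"] by (simp add: T.diff)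
  qed
  moreover have "openin (seminorm_topology mixed_seminorms) {y. w (y - x) < r / (K + 1)}"
    by (rule openin_seminorm_ball[OF vs mixed_seminorms_directed w(1)])
  ultimately show "\<exists>V. openin (seminorm_topology mixed_seminorms) V \<and> x \<in> V \<and>
      (\<forall>y\<in>V. q (S t y - S t x) < r)"
    using r w(2) mixedD(1)[OF w(1)] by (intro exI[of _ "{y. w (y - x) < r / (K + 1)}"]) simp
qed

lemma dual_comp_continuous:
  assumes "f \<in> dual smul (mixed_topology smul \<tau>)" "Vector_Spaces.linear smul smul T"
    and "continuous_map (mixed_topology smul \<tau>) (mixed_topology smul \<tau>) T"
  shows "f \<circ> T \<in> dual smul (mixed_topology smul \<tau>)"
  using assms continuous_map_compose[OF assms(3)]
  by (auto simp: dual_def Vector_Spaces.linear_iff)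

text \<open>Bi-equicontinuity of the single map makes it sequentially continuous for the mixed
  topology; the Mazur property turns sequential continuity of the composed functional into
  continuity.\<close>

lemma dual_comp_bi_equicontinuous:
  assumes Mazur: "Mazur smul (mixed_topology smul \<tau>)"
    and f: "f \<in> dual smul (mixed_topology smul \<tau>)" and lin: "Vector_Spaces.linear smul smul (S t)"
    and bl: "bounded_linear (S t)" and bi: "bi_equicontinuous \<tau> {t} S"
  shows "f \<circ> S t \<in> dual smul (mixed_topology smul \<tau>)"
proof -
  have fS: "Vector_Spaces.linear smul (*) (f \<circ> S t)"
    using f lin by (auto simp: dual_def Vector_Spaces.linear_iff)
  interpret T: Vector_Spaces.linear smul smul "S t" by (rule lin)
  have C: "norm (S s x) \<le> onorm (S t) * norm x" if "s \<in> {t}" for s x using onorm[OF bl] that by simp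
  have "(\<lambda>n. (f \<circ> S t) (u n)) \<longlonglongrightarrow> (f \<circ> S t) x"
    if u: "limitin (mixed_topology smul \<tau>) u x sequentially" for u x
  proof -
    have "limitin (mixed_topology smul \<tau>) (\<lambda>n. S t (u n)) (S t x) sequentially"
      unfolding limitin_mixed
    proof (intro ballI allI impI)
      fix q and r :: real assume "q \<in> mixed_seminorms" "0 < r"
      from bi_equicontinuous_mixed[OF C bi u this]
      show "\<forall>\<^sub>F n in sequentially. q (S t (u n) - S t x) < r" by (simp add: T.diff)
    qed
    moreover have "continuous_map (mixed_topology smul \<tau>) euclidean f" using f by (simp add: dual_def)
    ultimately have "limitin euclidean (f \<circ> (\<lambda>n. S t (u n))) (f (S t x)) sequentially"
      by (rule continuous_map_limit[rotated])
    then show ?thesis by (simp add: o_def)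
  qed
  then have "continuous_map (mixed_topology smul \<tau>) euclidean (f \<circ> S t)"
    using Mazur fS unfolding Mazur_def by blast
  then show ?thesis using fS by (simp add: dual_def)
qed

section \<open>The relations between the assertions\<close>

lemma bi_continuous_iff_equicontinuous:
  assumes Cseq: "C_sequential (mixed_topology smul \<tau>)" and k: "k_lcs_space I"
    and lin: "\<And>t. t \<in> topspace I \<Longrightarrow> Vector_Spaces.linear smul smul (S t)"
  shows "bi_continuous I \<tau> S \<and> bounded_family (topspace I) S \<longleftrightarrow>
    strongly_continuous I (mixed_topology smul \<tau>) S \<and>
    equicontinuous_family smul (mixed_topology smul \<tau>) (topspace I) S" (is "?L \<longleftrightarrow> ?R")
proof
  assume L: ?L
  then have bl: "\<And>t. t \<in> topspace I \<Longrightarrow> bounded_linear (S t)" by (simp add: bi_continuous_def)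
  obtain C where "\<And>t x. t \<in> topspace I \<Longrightarrow> norm (S t x) \<le> C * norm x"
    using L bounded_family_bound[of "topspace I" S] bl by blast
  then have "equicontinuous_family smul (mixed_topology smul \<tau>) (topspace I) S"
    using L by (intro C_sequential_equicontinuous[OF Cseq lin]) (auto simp: bi_continuous_def)
  then show ?R using L bl by (auto simp: bi_continuous_def intro: strongly_continuous_mixed[OF k])
next
  assume R: ?R
  then have eq: "equicontinuous_family smul (mixed_topology smul \<tau>) (topspace I) S" by simp
  note bounded = equicontinuous_imp_bounded[OF lin eq]
  have "on_compacts I (\<lambda>M. bounded_family M S)"
    using bounded(2) compactin_subset_topspace unfolding on_compacts_def bounded_family_def
    by (meson bdd_above_mono image_mono)
  then show ?L
    using R bounded strongly_continuous_tau equicontinuous_imp_bi_equicontinuous[OF eq]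
    by (auto simp: bi_continuous_def)
qed

lemma locally_bi_continuous_if_equicontinuous:
  assumes lin: "\<And>t. t \<in> topspace I \<Longrightarrow> Vector_Spaces.linear smul smul (S t)"
    and strong: "strongly_continuous I (mixed_topology smul \<tau>) S"
    and eq: "on_compacts I (\<lambda>M. equicontinuous_family smul (mixed_topology smul \<tau>) M S)"
  shows "locally_bi_continuous I \<tau> S"
proof -
  have lin': "Vector_Spaces.linear smul smul (S t)" if "compactin I M" "t \<in> M" for M t
    using lin compactin_subset_topspace that by blast
  have eq': "equicontinuous_family smul (mixed_topology smul \<tau>) M S" if "compactin I M" for M
    using eq that by (simp add: on_compacts_def)
  have "bounded_linear (S t)" if "t \<in> topspace I" for t
  proof -
    \<comment> \<open>Singletons are compact, so the local hypothesis reaches each single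
      map.\<close>
    have "compactin I {t}" using that by simp
    from equicontinuous_imp_bounded(1)[OF lin'[OF this] eq'[OF this]] show ?thesis by simp
  qed
  moreover have "bounded_family M S" if "compactin I M" for M
    by (rule equicontinuous_imp_bounded(2)[OF lin'[OF that] eq'[OF that]])
  ultimately show ?thesis
    using strongly_continuous_tau[OF strong] equicontinuous_imp_bi_equicontinuous[OF eq']
    by (auto simp: locally_bi_continuous_def on_compacts_def)
qed

lemma locally_bi_continuous_strongly_continuous_mixed:
  assumes "k_lcs_space I" and "locally_bi_continuous I \<tau> S"
  shows "strongly_continuous I (mixed_topology smul \<tau>) S"
  using assms by (auto simp: locally_bi_continuous_def intro: strongly_continuous_mixed)

lemma locally_bi_continuous_iff_C_sequential:
  assumes Cseq: "C_sequential (mixed_topology smul \<tau>)" and k: "k_lcs_space I"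
    and lin: "\<And>t. t \<in> topspace I \<Longrightarrow> Vector_Spaces.linear smul smul (S t)"
  shows "locally_bi_continuous I \<tau> S \<longleftrightarrow> strongly_continuous I (mixed_topology smul \<tau>) S \<and>
    on_compacts I (\<lambda>M. equicontinuous_family smul (mixed_topology smul \<tau>) M S)" (is "?L \<longleftrightarrow> ?R")
proof
  assume L: ?L
  have "equicontinuous_family smul (mixed_topology smul \<tau>) M S" if M: "compactin I M" for M
  proof -
    have MI: "M \<subseteq> topspace I" by (rule compactin_subset_topspace[OF M])
    have bl: "\<And>t. t \<in> M \<Longrightarrow> bounded_linear (S t)" and "bounded_family M S" and bi: "bi_equicontinuous \<tau> M S"
      using L M MI by (auto simp: locally_bi_continuous_def on_compacts_def)
    then obtain C where C: "\<And>t x. t \<in> M \<Longrightarrow> norm (S t x) \<le> C * norm x"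
      using bounded_family_bound[of M S] by blast
    show ?thesis by (rule C_sequential_equicontinuous[OF Cseq lin C bi]) (use MI in auto)
  qed
  then show ?R
    using locally_bi_continuous_strongly_continuous_mixed[OF k L] by (simp add: on_compacts_def)
qed (use locally_bi_continuous_if_equicontinuous lin in blast)

lemma strong_Mackey_equicontinuous_mixed:
  assumes Mackey: "strong_Mackey smul (mixed_topology smul \<tau>)"
    and strong: "strongly_continuous I (mixed_topology smul \<tau>) S"
    and dual: "\<And>t f. t \<in> topspace I \<Longrightarrow> f \<in> dual smul (mixed_topology smul \<tau>) \<Longrightarrow>
      f \<circ> S t \<in> dual smul (mixed_topology smul \<tau>)"
  shows "on_compacts I (\<lambda>M. equicontinuous_family smul (mixed_topology smul \<tau>) M S)"
  unfolding on_compacts_def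
proof (intro allI impI)
  fix M assume M: "compactin I M"
  show "equicontinuous_family smul (mixed_topology smul \<tau>) M S"
    using assms compactin_subset_topspace[OF M] unfolding mixed_topology_eq
    by (intro strong_Mackey_equicontinuous[OF mixed_seminorms_directed _ M]) auto
qed

text \<open>Equicontinuity on singletons is continuity of each map; conversely, composition with
  continuous maps preserves the dual, as the Mackey argument requires.\<close>

lemma locally_equicontinuous_iff_strong_Mackey:
  assumes Mackey: "strong_Mackey smul (mixed_topology smul \<tau>)"
    and lin: "\<And>t. t \<in> topspace I \<Longrightarrow> Vector_Spaces.linear smul smul (S t)"
    and strong: "strongly_continuous I (mixed_topology smul \<tau>) S"
  shows "on_compacts I (\<lambda>M. equicontinuous_family smul (mixed_topology smul \<tau>) M S) \<longleftrightarrow>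
    (\<forall>t\<in>topspace I. continuous_map (mixed_topology smul \<tau>) (mixed_topology smul \<tau>) (S t))"
proof
  assume L: "on_compacts I (\<lambda>M. equicontinuous_family smul (mixed_topology smul \<tau>) M S)"
  show "\<forall>t\<in>topspace I. continuous_map (mixed_topology smul \<tau>) (mixed_topology smul \<tau>) (S t)"
  proof
    fix t assume t: "t \<in> topspace I"
    then have "equicontinuous_family smul (mixed_topology smul \<tau>) {t} S"
      using L by (simp add: on_compacts_def)
    then show "continuous_map (mixed_topology smul \<tau>) (mixed_topology smul \<tau>) (S t)"
      by (rule equicontinuous_imp_continuous_map) (use lin t in auto)
  qed
next
  assume "\<forall>t\<in>topspace I. continuous_map (mixed_topology smul \<tau>) (mixed_topology smul \<tau>) (S t)"
  then show "on_compacts I (\<lambda>M. equicontinuous_family smul (mixed_topology smul \<tau>) M S)"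
    using dual_comp_continuous lin by (intro strong_Mackey_equicontinuous_mixed[OF Mackey strong]) blast
qed

lemma locally_bi_continuous_iff_strong_Mackey_Mazur:
  assumes Mackey: "strong_Mackey smul (mixed_topology smul \<tau>)"
    and Mazur: "Mazur smul (mixed_topology smul \<tau>)" and k: "k_lcs_space I"
    and lin: "\<And>t. t \<in> topspace I \<Longrightarrow> Vector_Spaces.linear smul smul (S t)"
  shows "locally_bi_continuous I \<tau> S \<longleftrightarrow> strongly_continuous I (mixed_topology smul \<tau>) S \<and>
    on_compacts I (\<lambda>M. equicontinuous_family smul (mixed_topology smul \<tau>) M S)" (is "?L \<longleftrightarrow> ?R")
proof
  assume L: ?L
  have strong: "strongly_continuous I (mixed_topology smul \<tau>) S"
    by (rule locally_bi_continuous_strongly_continuous_mixed[OF k L])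
  have "f \<circ> S t \<in> dual smul (mixed_topology smul \<tau>)"
    if t: "t \<in> topspace I" and f: "f \<in> dual smul (mixed_topology smul \<tau>)" for t f
  proof (rule dual_comp_bi_equicontinuous[where S = S and t = t, OF Mazur f lin[OF t]])
    show "bounded_linear (S t)" "bi_equicontinuous \<tau> {t} S"
      using L t by (auto simp: locally_bi_continuous_def on_compacts_def)
  qed
  then show ?R using strong strong_Mackey_equicontinuous_mixed[OF Mackey strong] by blast
qed (use locally_bi_continuous_if_equicontinuous lin in blast)

text \<open>Completeness enters through uniform boundedness, which extracts the norm bound on each
  compact set from strong continuity.\<close>

lemma locally_equitight_imp_equicontinuous:
  assumes complete: "complete (UNIV :: 'a set)"
    and lin: "\<And>t. t \<in> topspace I \<Longrightarrow> Vector_Spaces.linear smul smul (S t)"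
    and bl: "\<And>t. t \<in> topspace I \<Longrightarrow> bounded_linear (S t)"
    and strong: "strongly_continuous I (mixed_topology smul \<tau>) S"
    and tight: "on_compacts I (\<lambda>M. equitight P M S)"
  shows "on_compacts I (\<lambda>M. equicontinuous_family smul (mixed_topology smul \<tau>) M S)"
  unfolding on_compacts_def
proof (intro allI impI)
  fix M assume M: "compactin I M"
  obtain C where C: "0 \<le> C" "\<And>t x. t \<in> M \<Longrightarrow> norm (S t x) \<le> C * norm x"
    using strongly_continuous_bounded_on_compacts[OF complete strong bl M] by blast
  show "equicontinuous_family smul (mixed_topology smul \<tau>) M S"
    by (rule equitight_imp_equicontinuous[OF lin C])
      (use tight M compactin_subset_topspace[OF M] in \<open>auto simp: on_compacts_def\<close>)
qed

lemma bounded_equitight_imp_equicontinuous: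
  assumes lin: "\<And>t. t \<in> J \<Longrightarrow> Vector_Spaces.linear smul smul (S t)"
    and bl: "\<And>t. t \<in> J \<Longrightarrow> bounded_linear (S t)" and bounded: "bounded_family J S"
    and tight: "equitight P J S"
  shows "equicontinuous_family smul (mixed_topology smul \<tau>) J S"
proof -
  obtain C where C: "0 \<le> C" "\<And>t x. t \<in> J \<Longrightarrow> norm (S t x) \<le> C * norm x"
    using bounded bounded_family_bound[of J S] bl by blast
  show ?thesis by (rule equitight_imp_equicontinuous[OF lin C tight])
qed

end

theorem theorem5p3:
  fixes smul :: "'k::real_or_complex \<Rightarrow> 'a::real_normed_vector \<Rightarrow> 'a"
    and \<tau> \<gamma> \<gamma>\<^sub>s :: "'a topology"
    and P :: "('a \<Rightarrow> real) set"
    and I :: "'i topology"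
    and S :: "'i \<Rightarrow> 'a \<Rightarrow> 'a"
  assumes "saks_space smul \<tau> P"
    and "\<gamma> = mixed_topology smul \<tau>"
    and "\<gamma>\<^sub>s = submixed_topology P"
    and "Hausdorff_space I"
    and "\<forall>t\<in>topspace I. Vector_Spaces.linear smul smul (S t)"
  shows
    "(C_sequential \<gamma> \<and> k_lcs_space I \<longrightarrow>
      (bi_continuous I \<tau> S \<and> bounded_family (topspace I) S \<longleftrightarrow>
        strongly_continuous I \<gamma> S \<and> equicontinuous_family smul \<gamma> (topspace I) S) \<and>
      (locally_bi_continuous I \<tau> S \<longleftrightarrow>
        strongly_continuous I \<gamma> S \<and> on_compacts I (\<lambda>M. equicontinuous_family smul \<gamma> M S))) \<and>
    (\<gamma> = \<gamma>\<^sub>s \<longrightarrow>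
      (strongly_continuous I \<gamma> S \<and> equicontinuous_family smul \<gamma> (topspace I) S \<longrightarrow>
        strongly_continuous I \<gamma> S \<and> equitight P (topspace I) S) \<and>
      (strongly_continuous I \<gamma> S \<and> on_compacts I (\<lambda>M. equicontinuous_family smul \<gamma> M S) \<longrightarrow>
        strongly_continuous I \<gamma> S \<and> on_compacts I (\<lambda>M. equitight P M S))) \<and>
    (complete (UNIV :: 'a set) \<and> (\<forall>t\<in>topspace I. bounded_linear (S t)) \<longrightarrow>
      (strongly_continuous I \<gamma> S \<and> on_compacts I (\<lambda>M. equitight P M S) \<longrightarrow>
        strongly_continuous I \<gamma> S \<and> on_compacts I (\<lambda>M. equicontinuous_family smul \<gamma> M S))) \<and>
    ((\<forall>t\<in>topspace I. bounded_linear (S t)) \<and> bounded_family (topspace I) S \<longrightarrow>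
      (strongly_continuous I \<gamma> S \<and> equitight P (topspace I) S \<longrightarrow>
        strongly_continuous I \<gamma> S \<and> equicontinuous_family smul \<gamma> (topspace I) S)) \<and>
    (strong_Mackey smul \<gamma> \<longrightarrow>
      (strongly_continuous I \<gamma> S \<and> on_compacts I (\<lambda>M. equicontinuous_family smul \<gamma> M S) \<longleftrightarrow>
        strongly_continuous I \<gamma> S \<and> (\<forall>t\<in>topspace I. continuous_map \<gamma> \<gamma> (S t)))) \<and>
    (strong_Mackey smul \<gamma> \<and> Mazur smul \<gamma> \<and> k_lcs_space I \<longrightarrow>
      (locally_bi_continuous I \<tau> S \<longleftrightarrow>
        strongly_continuous I \<gamma> S \<and> on_compacts I (\<lambda>M. equicontinuous_family smul \<gamma> M S)) \<and>
      (strongly_continuous I \<gamma> S \<and> on_compacts I (\<lambda>M. equicontinuous_family smul \<gamma> M S) \<longleftrightarrow>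
        strongly_continuous I \<gamma> S \<and> (\<forall>t\<in>topspace I. continuous_map \<gamma> \<gamma> (S t))))"
proof -
  interpret saks_space smul \<tau> P by fact
  have lin: "\<And>t. t \<in> topspace I \<Longrightarrow> Vector_Spaces.linear smul smul (S t)" using assms(5) by blast
  show ?thesis
    unfolding assms(2)
  \<comment> \<open>One case arises for each of the six outer implications; in cases 3 and 4 the
    assertion about equitightness joins the premises.\<close>
  proof ((intro conjI; intro impI; (elim conjE)?), goal_cases)
    case 1
    show ?case
      using bi_continuous_iff_equicontinuous[where S = S and I = I, OF 1 lin] locally_bi_continuous_iff_C_sequential[where S = S and I = I, OF 1 lin]
      by (rule conjI)
  next
    case 2
    show ?case using equicontinuous_imp_equitight by (auto simp: on_compacts_def)
  next
    case 3
    then show ?case using locally_equitight_imp_equicontinuous[where S = S and I = I, OF 3(1) lin _ 3(3,4)] by blast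
  next
    case 4
    then show ?case using bounded_equitight_imp_equicontinuous[where S = S and J = "topspace I", OF lin _ 4(2,4)] by blast
  next
    case 5
    show ?case using locally_equicontinuous_iff_strong_Mackey[where S = S and I = I, OF 5 lin] by blast
  next
    case 6
    show ?case
      using locally_bi_continuous_iff_strong_Mackey_Mazur[where S = S and I = I, OF 6 lin]
        locally_equicontinuous_iff_strong_Mackey[where S = S and I = I, OF 6(1) lin] by blast
  qed
qed

end
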